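(* Let $R$ be an associative ring with identity and $M$ a left $R$-module which is projective in $\sigma[M]$. Suppose that for every fully invariant submodule $N\leq M$ the factor module $M/N$ has finite uniform dimension. Then the frame $SP(M)$ is totally spatial.
   Context: $\sigma[M]$ is the full subcategory of modules subgenerated by $M$. For $N,L\leq M$, $N_ML=\sum\{f(N)\mid f\in\mathrm{Hom}_R(M,L)\}$. A fully invariant submodule $N\neq M$ is semiprime in $M$ if for every fully invariant $K\leq M$, $K_MK\subseteq N$ implies $K\subseteq N$. $SP(M)$ is the set of semiprime submodules of $M$ together with $M$, ordered by inclusion; it is a frame. A frame is spatial if it is isomorphic to the frame $\mathcal{O}(X)$ of open sets of some topological space $X$, and totally spatial if each of its quotient frames is spatial. *)

theory Defs
  imports "HOL-Analysis.Analysis" "HOL-Algebra.Module" "HOL-Algebra.AbelCoset"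
begin

text \<open>HOL-Algebra's module locale requires a commutative ring, so left modules over
an arbitrary ring (HOL-Algebra ring = associative ring with identity) are defined here.
The multiplicative fields of the module record are ignored.\<close>

definition left_module :: "'r ring \<Rightarrow> ('r, 'a) module \<Rightarrow> bool" where
  "left_module R M \<longleftrightarrow> ring R \<and> abelian_group M \<and>
     (\<forall>a\<in>carrier R. \<forall>x\<in>carrier M. a \<odot>\<^bsub>M\<^esub> x \<in> carrier M) \<and>
     (\<forall>a\<in>carrier R. \<forall>b\<in>carrier R. \<forall>x\<in>carrier M.
        (a \<oplus>\<^bsub>R\<^esub> b) \<odot>\<^bsub>M\<^esub> x = a \<odot>\<^bsub>M\<^esub> x \<oplus>\<^bsub>M\<^esub> b \<odot>\<^bsub>M\<^esub> x) \<and>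
     (\<forall>a\<in>carrier R. \<forall>x\<in>carrier M. \<forall>y\<in>carrier M.
        a \<odot>\<^bsub>M\<^esub> (x \<oplus>\<^bsub>M\<^esub> y) = a \<odot>\<^bsub>M\<^esub> x \<oplus>\<^bsub>M\<^esub> a \<odot>\<^bsub>M\<^esub> y) \<and>
     (\<forall>a\<in>carrier R. \<forall>b\<in>carrier R. \<forall>x\<in>carrier M.
        (a \<otimes>\<^bsub>R\<^esub> b) \<odot>\<^bsub>M\<^esub> x = a \<odot>\<^bsub>M\<^esub> (b \<odot>\<^bsub>M\<^esub> x)) \<and>
     (\<forall>x\<in>carrier M. \<one>\<^bsub>R\<^esub> \<odot>\<^bsub>M\<^esub> x = x)"

definition lhom :: "'r ring \<Rightarrow> ('r, 'a) module \<Rightarrow> ('r, 'b) module \<Rightarrow> ('a \<Rightarrow> 'b) set" where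
  "lhom R M N = {f. (\<forall>x\<in>carrier M. f x \<in> carrier N) \<and>
     (\<forall>x\<in>carrier M. \<forall>y\<in>carrier M. f (x \<oplus>\<^bsub>M\<^esub> y) = f x \<oplus>\<^bsub>N\<^esub> f y) \<and>
     (\<forall>a\<in>carrier R. \<forall>x\<in>carrier M. f (a \<odot>\<^bsub>M\<^esub> x) = a \<odot>\<^bsub>N\<^esub> f x)}"

text \<open>Submodule generated by a subset (intersection of all submodules containing it);
the sum of a family of submodules is the submodule generated by their union.\<close>
definition gen_submodule :: "'r ring \<Rightarrow> ('r, 'a) module \<Rightarrow> 'a set \<Rightarrow> 'a set" where
  "gen_submodule R M S = \<Inter>{H. submodule H R M \<and> S \<subseteq> H}"

definition factor_module :: "'r ring \<Rightarrow> ('r, 'a) module \<Rightarrow> 'a set \<Rightarrow> ('r, 'a set) module" where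
  "factor_module R M N = \<lparr>carrier = A_RCOSETS M N, monoid.mult = (\<lambda>X Y. undefined),
     one = undefined, zero = N, add = set_add M,
     smult = (\<lambda>a X. set_add M ((\<lambda>x. a \<odot>\<^bsub>M\<^esub> x) ` X) N)\<rparr>"

definition finite_uniform_dim :: "'r ring \<Rightarrow> ('r, 'a) module \<Rightarrow> bool" where
  "finite_uniform_dim R M \<longleftrightarrow>
     \<not> (\<exists>K :: nat \<Rightarrow> 'a set.
          (\<forall>i. submodule (K i) R M \<and> K i \<noteq> {\<zero>\<^bsub>M\<^esub>}) \<and>
          (\<forall>n. K n \<inter> gen_submodule R M (\<Union>i\<in>{i. i \<noteq> n}. K i) = {\<zero>\<^bsub>M\<^esub>}))"

definition M_generated :: "'r ring \<Rightarrow> ('r, 'a) module \<Rightarrow> ('r, 'b) module \<Rightarrow> bool" where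
  "M_generated R M K \<longleftrightarrow>
     carrier K = gen_submodule R K (\<Union>f\<in>lhom R M K. f ` carrier M)"

definition in_sigma :: "'r ring \<Rightarrow> ('r, 'a) module \<Rightarrow> ('r, 'b) module \<Rightarrow> bool" where
  "in_sigma R M N \<longleftrightarrow> left_module R N \<and>
     (\<exists>K :: ('r, 'b) module. left_module R K \<and> M_generated R M K \<and>
        (\<exists>\<iota>\<in>lhom R N K. inj_on \<iota> (carrier N)))"

definition projective_in_sigma :: "'r ring \<Rightarrow> ('r, 'a) module \<Rightarrow> bool" where
  "projective_in_sigma R M \<longleftrightarrow>
     (\<forall>(N :: ('r, 'a list) module) (L :: ('r, 'a list) module) g f.
        in_sigma R M N \<and> in_sigma R M L \<and> g \<in> lhom R N L \<and> g ` carrier N = carrier L \<and>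
        f \<in> lhom R M L \<longrightarrow>
        (\<exists>h\<in>lhom R M N. \<forall>x\<in>carrier M. g (h x) = f x))"

definition fully_invariant :: "'r ring \<Rightarrow> ('r, 'a) module \<Rightarrow> 'a set \<Rightarrow> bool" where
  "fully_invariant R M N \<longleftrightarrow> submodule N R M \<and> (\<forall>f\<in>lhom R M M. f ` N \<subseteq> N)"

definition sub_product :: "'r ring \<Rightarrow> ('r, 'a) module \<Rightarrow> 'a set \<Rightarrow> 'a set \<Rightarrow> 'a set" where
  "sub_product R M N L =
     gen_submodule R M (\<Union>{f ` N | f. f \<in> lhom R M M \<and> f ` carrier M \<subseteq> L})"

definition semiprime_sub :: "'r ring \<Rightarrow> ('r, 'a) module \<Rightarrow> 'a set \<Rightarrow> bool" where
  "semiprime_sub R M N \<longleftrightarrow> fully_invariant R M N \<and> N \<noteq> carrier M \<and>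
     (\<forall>K. fully_invariant R M K \<and> sub_product R M K K \<subseteq> N \<longrightarrow> K \<subseteq> N)"

definition SP :: "'r ring \<Rightarrow> ('r, 'a) module \<Rightarrow> 'a set set" where
  "SP R M = {N. semiprime_sub R M N} \<union> {carrier M}"

definition is_lub :: "'e set \<Rightarrow> ('e \<Rightarrow> 'e \<Rightarrow> bool) \<Rightarrow> 'e set \<Rightarrow> 'e \<Rightarrow> bool" where
  "is_lub A lq S x \<longleftrightarrow> x \<in> A \<and> (\<forall>s\<in>S. lq s x) \<and> (\<forall>y\<in>A. (\<forall>s\<in>S. lq s y) \<longrightarrow> lq x y)"

definition is_glb :: "'e set \<Rightarrow> ('e \<Rightarrow> 'e \<Rightarrow> bool) \<Rightarrow> 'e set \<Rightarrow> 'e \<Rightarrow> bool" where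
  "is_glb A lq S x \<longleftrightarrow> x \<in> A \<and> (\<forall>s\<in>S. lq x s) \<and> (\<forall>y\<in>A. (\<forall>s\<in>S. lq y s) \<longrightarrow> lq y x)"

definition fjoin :: "'e set \<Rightarrow> ('e \<Rightarrow> 'e \<Rightarrow> bool) \<Rightarrow> 'e set \<Rightarrow> 'e" where
  "fjoin A lq S = (THE x. is_lub A lq S x)"

definition fmeet :: "'e set \<Rightarrow> ('e \<Rightarrow> 'e \<Rightarrow> bool) \<Rightarrow> 'e \<Rightarrow> 'e \<Rightarrow> 'e" where
  "fmeet A lq a b = (THE x. is_glb A lq {a, b} x)"

definition is_frame :: "'e set \<Rightarrow> ('e \<Rightarrow> 'e \<Rightarrow> bool) \<Rightarrow> bool" where
  "is_frame A lq \<longleftrightarrow>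
     (\<forall>x\<in>A. lq x x) \<and> (\<forall>x\<in>A. \<forall>y\<in>A. lq x y \<and> lq y x \<longrightarrow> x = y) \<and>
     (\<forall>x\<in>A. \<forall>y\<in>A. \<forall>z\<in>A. lq x y \<and> lq y z \<longrightarrow> lq x z) \<and>
     (\<forall>S\<subseteq>A. \<exists>x. is_lub A lq S x) \<and>
     (\<forall>a\<in>A. \<forall>S\<subseteq>A. fmeet A lq a (fjoin A lq S) = fjoin A lq ((\<lambda>s. fmeet A lq a s) ` S))"

text \<open>Frame congruences: equivalences compatible with binary meets and arbitrary joins.
The quotient frames of A are (up to isomorphism) exactly the A/theta.\<close>
definition frame_congruence :: "'e set \<Rightarrow> ('e \<Rightarrow> 'e \<Rightarrow> bool) \<Rightarrow> ('e \<times> 'e) set \<Rightarrow> bool" where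
  "frame_congruence A lq \<theta> \<longleftrightarrow> equiv A \<theta> \<and>
     (\<forall>a b c d. (a, b) \<in> \<theta> \<and> (c, d) \<in> \<theta> \<longrightarrow> (fmeet A lq a c, fmeet A lq b d) \<in> \<theta>) \<and>
     (\<forall>P\<subseteq>\<theta>. (fjoin A lq (fst ` P), fjoin A lq (snd ` P)) \<in> \<theta>)"

definition quot_le :: "'e set \<Rightarrow> ('e \<Rightarrow> 'e \<Rightarrow> bool) \<Rightarrow> ('e \<times> 'e) set \<Rightarrow> 'e set \<Rightarrow> 'e set \<Rightarrow> bool" where
  "quot_le A lq \<theta> X Y \<longleftrightarrow> (\<exists>x\<in>X. \<exists>y\<in>Y. (x, fmeet A lq x y) \<in> \<theta>)"

text \<open>Spatial: order-isomorphic to the frame of open sets of a topological space.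
The points may be taken in 'e set (points of a frame are subsets of it).\<close>
definition spatial :: "'e set \<Rightarrow> ('e \<Rightarrow> 'e \<Rightarrow> bool) \<Rightarrow> bool" where
  "spatial A lq \<longleftrightarrow>
     (\<exists>(T :: 'e set topology) \<phi>. bij_betw \<phi> A {U. openin T U} \<and>
        (\<forall>x\<in>A. \<forall>y\<in>A. lq x y \<longleftrightarrow> \<phi> x \<subseteq> \<phi> y))"

definition totally_spatial :: "'e set \<Rightarrow> ('e \<Rightarrow> 'e \<Rightarrow> bool) \<Rightarrow> bool" where
  "totally_spatial A lq \<longleftrightarrow> is_frame A lq \<and>
     (\<forall>\<theta>. frame_congruence A lq \<theta> \<longrightarrow> spatial (A // \<theta>) (quot_le A lq \<theta>))"

end

theory Submission
  imports Defs
begin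

text \<open>Every \<open>a\<close> in \<open>SP(M)\<close> admits no infinite sequence of elements \<open>c\<^sub>n\<close> not below \<open>a\<close> with pairwise
  intersections inside \<open>a\<close>: by frame distributivity it would give an infinite independent family of
  submodules of \<open>M/a\<close>. So below any \<open>x\<close> not contained in \<open>a\<close> there is a \<open>k\<close>, not contained in \<open>a\<close>, that
  cannot be split modulo \<open>a\<close>, and then \<open>k \<rightarrow> a\<close> (Heyting implication) is a prime element above \<open>a\<close> but not
  above \<open>x\<close>. Since \<open>k \<rightarrow> a\<close> is fixed by every nucleus fixing \<open>a\<close>, each quotient frame has enough
  primes. Projectivity enters only through the distributivity of \<open>SP(M)\<close>.\<close>

subsection \<open>Spatiality of quotients of frames of sets\<close>

text \<open>Meets in \<open>SP R M\<close> are intersections, but joins are in general larger than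
  sums, and the lattice of submodules need not be distributive; the frame law therefore cannot be
  inherited and is obtained from residuals. A residual that is itself semiprime bounds a join as
  soon as it contains each joinand. That it is semiprime needs an associativity-like inclusion
  between products, and this is where an endomorphism with values in a sum of images
  \<open>h i (K)\<close> must be lifted along the canonical map from a direct sum of copies of
  \<open>K\<close>. Since \<open>projective_in_sigma\<close> speaks only about modules on
  \<open>'a list\<close>, both ends of this lifting problem have to be built on lists; the index set
  can be the type \<open>'a\<close> itself, because one endomorphism per element of the union of the
  images is enough. That joins exceed sums is harmless for uniform dimension: an element that meets
  the join of the others trivially modulo \<open>a\<close> also meets their sum trivially. A
  congruence is replaced by the nucleus taking each element to the largest member of its class, so
  that the points of the quotient are the primes fixed by this nucleus.\<close>

lemma spatialI:
  fixes A :: "'e set" and \<phi> :: "'e \<Rightarrow> 'e set set"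
  assumes ord: "\<And>x y. x \<in> A \<Longrightarrow> y \<in> A \<Longrightarrow> lq x y \<longleftrightarrow> \<phi> x \<subseteq> \<phi> y"
    and inj: "inj_on \<phi> A"
    and inter: "\<And>x y. x \<in> A \<Longrightarrow> y \<in> A \<Longrightarrow> \<phi> x \<inter> \<phi> y \<in> \<phi> ` A"
    and union: "\<And>S. S \<subseteq> A \<Longrightarrow> \<Union>(\<phi> ` S) \<in> \<phi> ` A"
  shows "spatial A lq"
proof -
  have top: "istopology (\<lambda>U. U \<in> \<phi> ` A)"
    unfolding istopology_def
  proof (intro conjI allI impI)
    fix S T assume "S \<in> \<phi> ` A" "T \<in> \<phi> ` A"
    then show "S \<inter> T \<in> \<phi> ` A" using inter by blast
  next
    fix \<K> assume "\<forall>K\<in>\<K>. K \<in> \<phi> ` A"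
    then obtain S where "S \<subseteq> A" "\<K> = \<phi> ` S" by (meson subset_imageE subsetI)
    then show "\<Union>\<K> \<in> \<phi> ` A" using union by blast
  qed
  have "{U. openin (topology (\<lambda>U. U \<in> \<phi> ` A)) U} = \<phi> ` A"
    using topology_inverse'[OF top] by auto
  then have "bij_betw \<phi> A {U. openin (topology (\<lambda>U. U \<in> \<phi> ` A)) U}"
    using inj by (simp add: bij_betw_def)
  then show ?thesis unfolding spatial_def using ord by blast
qed

text \<open>Distributivity is assumed only in the direction that is not automatic, and with an
  arbitrary upper bound \<open>b\<close> in place of the join of the meets, which is the form that
  residuals deliver. The intersection of all upper bounds is the join, written out because
  \<open>join\<close> is not yet available.\<close>

locale set_frame =
  fixes \<A> :: "'a set set" and T :: "'a set"
  assumes top_mem: "T \<in> \<A>"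
    and le_top: "a \<in> \<A> \<Longrightarrow> a \<subseteq> T"
    and Inter_mem: "\<lbrakk>S \<subseteq> \<A>; S \<noteq> {}\<rbrakk> \<Longrightarrow> \<Inter>S \<in> \<A>"
    and inter_Sup_le: "\<lbrakk>a \<in> \<A>; b \<in> \<A>; S \<subseteq> \<A>; \<And>s. s \<in> S \<Longrightarrow> a \<inter> s \<subseteq> b\<rbrakk>
      \<Longrightarrow> a \<inter> \<Inter>{x\<in>\<A>. \<Union>S \<subseteq> x} \<subseteq> b"
begin

definition join :: "'a set set \<Rightarrow> 'a set" where
  "join S = \<Inter>{x\<in>\<A>. \<Union>S \<subseteq> x}"

lemma join_mem: "S \<subseteq> \<A> \<Longrightarrow> join S \<in> \<A>"
  unfolding join_def by (rule Inter_mem) (blast intro: top_mem dest: le_top)+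

lemma join_upper: "s \<in> S \<Longrightarrow> s \<subseteq> join S"
  unfolding join_def by blast

lemma join_least: "\<lbrakk>b \<in> \<A>; \<And>s. s \<in> S \<Longrightarrow> s \<subseteq> b\<rbrakk> \<Longrightarrow> join S \<subseteq> b"
  unfolding join_def by blast

lemma join_le_iff: "b \<in> \<A> \<Longrightarrow> join S \<subseteq> b \<longleftrightarrow> (\<forall>s\<in>S. s \<subseteq> b)"
  by (meson join_least join_upper subset_trans)

lemma inter_mem: "\<lbrakk>a \<in> \<A>; b \<in> \<A>\<rbrakk> \<Longrightarrow> a \<inter> b \<in> \<A>"
  using Inter_mem[of "{a, b}"] by simp

lemma inter_join_le:
  "\<lbrakk>a \<in> \<A>; b \<in> \<A>; S \<subseteq> \<A>; \<And>s. s \<in> S \<Longrightarrow> a \<inter> s \<subseteq> b\<rbrakk> \<Longrightarrow> a \<inter> join S \<subseteq> b"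
  unfolding join_def by (rule inter_Sup_le)

lemma is_lub_join: "S \<subseteq> \<A> \<Longrightarrow> is_lub \<A> (\<subseteq>) S (join S)"
  unfolding is_lub_def by (simp add: join_mem join_upper join_le_iff)

lemma fjoin_eq: "S \<subseteq> \<A> \<Longrightarrow> fjoin \<A> (\<subseteq>) S = join S"
  unfolding fjoin_def
proof (rule the_equality)
  fix x assume S: "S \<subseteq> \<A>" and "is_lub \<A> (\<subseteq>) S x"
  then show "x = join S"
    unfolding is_lub_def by (intro subset_antisym) (simp_all add: join_mem join_upper join_least)
qed (rule is_lub_join)

lemma fmeet_eq: "\<lbrakk>a \<in> \<A>; b \<in> \<A>\<rbrakk> \<Longrightarrow> fmeet \<A> (\<subseteq>) a b = a \<inter> b"
  unfolding fmeet_def is_glb_def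
proof (rule the_equality)
  assume "a \<in> \<A>" "b \<in> \<A>"
  then have "a \<inter> b \<in> \<A>" by (rule inter_mem)
  then show "a \<inter> b \<in> \<A> \<and> (\<forall>s\<in>{a, b}. a \<inter> b \<subseteq> s) \<and>
      (\<forall>y\<in>\<A>. (\<forall>s\<in>{a, b}. y \<subseteq> s) \<longrightarrow> y \<subseteq> a \<inter> b)" by simp
  fix x
  assume x: "x \<in> \<A> \<and> (\<forall>s\<in>{a, b}. x \<subseteq> s) \<and>
      (\<forall>y\<in>\<A>. (\<forall>s\<in>{a, b}. y \<subseteq> s) \<longrightarrow> y \<subseteq> x)"
  then have "a \<inter> b \<subseteq> x" using \<open>a \<inter> b \<in> \<A>\<close> by simp
  then show "x = a \<inter> b" using x by (intro subset_antisym) simp_all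
qed

lemma is_frame: "is_frame \<A> (\<subseteq>)"
proof -
  have "fmeet \<A> (\<subseteq>) a (fjoin \<A> (\<subseteq>) S) = fjoin \<A> (\<subseteq>) ((\<lambda>s. fmeet \<A> (\<subseteq>) a s) ` S)"
    if a: "a \<in> \<A>" and S: "S \<subseteq> \<A>" for a S
  proof -
    have im: "(\<lambda>s. fmeet \<A> (\<subseteq>) a s) ` S = (\<lambda>s. a \<inter> s) ` S"
      using a S by (intro image_cong) (auto simp: fmeet_eq)
    have sub: "(\<lambda>s. a \<inter> s) ` S \<subseteq> \<A>"
      using a S inter_mem by blast
    have "a \<inter> join S = join ((\<lambda>s. a \<inter> s) ` S)"
    proof
      show "a \<inter> join S \<subseteq> join ((\<lambda>s. a \<inter> s) ` S)"
        using a S sub by (intro inter_join_le join_mem join_upper) auto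
      show "join ((\<lambda>s. a \<inter> s) ` S) \<subseteq> a \<inter> join S"
        using a S inter_mem join_mem join_upper by (intro join_least) blast+
    qed
    then show ?thesis
      using a S sub by (simp add: im fjoin_eq fmeet_eq join_mem)
  qed
  then show ?thesis
    unfolding is_frame_def by (intro conjI) (blast intro: is_lub_join)+
qed

section \<open>Heyting implication, primes and nuclei\<close>

definition imp :: "'a set \<Rightarrow> 'a set \<Rightarrow> 'a set" where
  "imp k a = join {y\<in>\<A>. y \<inter> k \<subseteq> a}"

lemma imp_mem: "imp k a \<in> \<A>"
  unfolding imp_def by (rule join_mem) auto

text \<open>Distributivity puts the join \<open>imp k a\<close> itself among the elements
  \<open>y\<close> with \<open>y \<inter> k \<subseteq> a\<close> that it joins; the rest is the
  adjunction of meet and implication.\<close>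

lemma le_imp_iff:
  assumes "y \<in> \<A>" "k \<in> \<A>" "a \<in> \<A>"
  shows "y \<subseteq> imp k a \<longleftrightarrow> y \<inter> k \<subseteq> a"
proof
  have "k \<inter> imp k a \<subseteq> a"
    unfolding imp_def using assms by (intro inter_join_le) auto
  then show "y \<subseteq> imp k a \<Longrightarrow> y \<inter> k \<subseteq> a" by blast
  show "y \<inter> k \<subseteq> a \<Longrightarrow> y \<subseteq> imp k a"
    unfolding imp_def using assms by (intro join_upper) auto
qed

text \<open>The top \<open>T\<close> qualifies as well. It never becomes a point that separates
  anything, because a point counts for an element only if it fails to lie above it.\<close>

definition prime :: "'a set \<Rightarrow> bool" where
  "prime p \<longleftrightarrow> p \<in> \<A> \<and> (\<forall>y\<in>\<A>. \<forall>z\<in>\<A>. y \<inter> z \<subseteq> p \<longrightarrow> y \<subseteq> p \<or> z \<subseteq> p)"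

definition nucleus :: "('a set \<Rightarrow> 'a set) \<Rightarrow> bool" where
  "nucleus j \<longleftrightarrow> (\<forall>a\<in>\<A>. j a \<in> \<A> \<and> a \<subseteq> j a \<and> j (j a) = j a) \<and>
     (\<forall>a\<in>\<A>. \<forall>b\<in>\<A>. j (a \<inter> b) = j a \<inter> j b)"

lemma nucleus_mono: "\<lbrakk>nucleus j; a \<in> \<A>; b \<in> \<A>; a \<subseteq> b\<rbrakk> \<Longrightarrow> j a \<subseteq> j b"
proof -
  assume j: "nucleus j" and ab: "a \<in> \<A>" "b \<in> \<A>" "a \<subseteq> b"
  have "j (a \<inter> b) = j a \<inter> j b" using j ab unfolding nucleus_def by blast
  moreover have "a \<inter> b = a" using ab by blast
  ultimately show "j a \<subseteq> j b" by auto
qed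

text \<open>Since \<open>k \<subseteq> j k\<close>, the meet of \<open>j (imp k a)\<close> with
  \<open>k\<close> lies in \<open>j (imp k a \<inter> k)\<close>, hence in \<open>j a = a\<close>;
  the adjunction then gives \<open>j (imp k a) \<subseteq> imp k a\<close>.\<close>

lemma nucleus_imp:
  assumes j: "nucleus j" and ka: "k \<in> \<A>" "a \<in> \<A>" and ja: "j a = a"
  shows "j (imp k a) = imp k a"
proof
  have mem: "j (imp k a) \<in> \<A>" using j imp_mem unfolding nucleus_def by blast
  have "imp k a \<inter> k \<subseteq> a" using le_imp_iff[OF imp_mem ka] by blast
  then have "j (imp k a \<inter> k) \<subseteq> a"
    using nucleus_mono[OF j] ka ja imp_mem inter_mem by metis
  moreover have "j (imp k a) \<inter> k \<subseteq> j (imp k a \<inter> k)"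
    using j ka imp_mem unfolding nucleus_def by blast
  ultimately show "j (imp k a) \<subseteq> imp k a"
    using le_imp_iff[OF mem ka] by blast
  show "imp k a \<subseteq> j (imp k a)" using j imp_mem unfolding nucleus_def by blast
qed

end

text \<open>The extra hypothesis is the lattice-theoretic form of finite uniform dimension.\<close>

locale set_frame_finite_dim = set_frame \<A> T for \<A> :: "'a set set" and T +
  assumes no_independent: "\<And>a (K :: nat \<Rightarrow> 'a set) J. \<lbrakk>a \<in> \<A>; \<And>n. K n \<in> \<A>; \<And>n. J n \<in> \<A>; \<And>n. a \<subset> K n;
      \<And>n i. i \<noteq> n \<Longrightarrow> K i \<subseteq> J n; \<And>n. K n \<inter> J n = a\<rbrakk> \<Longrightarrow> False"
begin

text \<open>Joining each \<open>c n\<close> with \<open>a\<close> turns pairwise disjointness modulo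
  \<open>a\<close> into independence over \<open>a\<close>. Distributivity is used twice: over the
  family of the other \<open>c i\<close>, and then over the pair \<open>{a, c n}\<close>.\<close>

lemma no_disjoint_sequence:
  fixes c :: "nat \<Rightarrow> 'a set"
  assumes a: "a \<in> \<A>" and c: "\<And>n. c n \<in> \<A>" "\<And>n. \<not> c n \<subseteq> a"
    and disj: "\<And>m n. m \<noteq> n \<Longrightarrow> c m \<inter> c n \<subseteq> a"
  shows False
proof (rule no_independent[of a "\<lambda>n. join {a, c n}" "\<lambda>n. join (insert a (c ` (- {n})))"])
  show "a \<in> \<A>" by fact
  show K: "join {a, c n} \<in> \<A>" for n using a c by (intro join_mem) auto
  show J: "join (insert a (c ` (- {n}))) \<in> \<A>" for n using a c by (intro join_mem) auto
  show "a \<subset> join {a, c n}" for n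
    using join_upper[of a "{a, c n}"] join_upper[of "c n" "{a, c n}"] c(2)[of n] by blast
  show "join {a, c i} \<subseteq> join (insert a (c ` (- {n})))" if "i \<noteq> n" for n i
    using that J by (intro join_least) (auto intro!: subsetD[OF join_upper])
  show "join {a, c n} \<inter> join (insert a (c ` (- {n}))) = a" for n
  proof
    have "c n \<inter> join (insert a (c ` (- {n}))) \<subseteq> a"
      using a c disj by (intro inter_join_le) fastforce+
    then have "join (insert a (c ` (- {n}))) \<inter> join {a, c n} \<subseteq> a"
      using a c J by (intro inter_join_le) auto
    then show "join {a, c n} \<inter> join (insert a (c ` (- {n}))) \<subseteq> a" by blast
    show "a \<subseteq> join {a, c n} \<inter> join (insert a (c ` (- {n})))"
      using join_upper by simp
  qed
qed

text \<open>Otherwise every element below \<open>x\<close> and not below \<open>a\<close> splits into two parts that are disjoint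
  modulo \<open>a\<close>; splitting the second part again and again yields an infinite disjoint sequence.\<close>

lemma exists_uniform:
  assumes a: "a \<in> \<A>" and x: "x \<in> \<A>" "\<not> x \<subseteq> a"
  shows "\<exists>k\<in>\<A>. k \<subseteq> x \<and> \<not> k \<subseteq> a \<and>
    (\<forall>y\<in>\<A>. \<forall>z\<in>\<A>. y \<inter> z \<inter> k \<subseteq> a \<longrightarrow> y \<inter> k \<subseteq> a \<or> z \<inter> k \<subseteq> a)"
proof (rule ccontr)
  assume "\<not> ?thesis"
  then have neg: "\<forall>k\<in>\<A>. k \<subseteq> x \<longrightarrow> k \<subseteq> a \<or>
      (\<exists>y\<in>\<A>. \<exists>z\<in>\<A>. y \<inter> z \<inter> k \<subseteq> a \<and> \<not> y \<inter> k \<subseteq> a \<and> \<not> z \<inter> k \<subseteq> a)"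
    by simp
  define good where "good k \<longleftrightarrow> k \<in> \<A> \<and> k \<subseteq> x \<and> \<not> k \<subseteq> a" for k
  have split: "\<exists>y z. good z \<and> y \<in> \<A> \<and> \<not> y \<subseteq> a \<and> y \<subseteq> k \<and> z \<subseteq> k \<and> y \<inter> z \<subseteq> a"
    if k: "good k" for k
  proof -
    have k': "k \<in> \<A>" "k \<subseteq> x" "\<not> k \<subseteq> a" using k by (simp_all add: good_def)
    then have "\<exists>y\<in>\<A>. \<exists>z\<in>\<A>. y \<inter> z \<inter> k \<subseteq> a \<and> \<not> y \<inter> k \<subseteq> a \<and> \<not> z \<inter> k \<subseteq> a"
      using bspec[OF neg k'(1)] by simp
    then obtain y z where yz: "y \<in> \<A>" "z \<in> \<A>" "y \<inter> z \<inter> k \<subseteq> a"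
        "\<not> y \<inter> k \<subseteq> a" "\<not> z \<inter> k \<subseteq> a"
      by (elim bexE conjE)
    have "good (z \<inter> k)"
      unfolding good_def by (intro conjI inter_mem le_infI2) (use yz k' in simp_all)
    moreover have "y \<inter> k \<in> \<A>" using yz(1) k'(1) by (rule inter_mem)
    moreover have "(y \<inter> k) \<inter> (z \<inter> k) \<subseteq> a" using yz(3) by (simp add: Int_ac)
    ultimately show ?thesis using yz(4)
      by (intro exI[of _ "y \<inter> k"] exI[of _ "z \<inter> k"] conjI) (simp_all add: le_infI2)
  qed
  \<comment> \<open>The part \<open>y\<close> that is set aside stays under an existential, so that
    the recursion carries only the part \<open>z\<close> still to be split; the parts set aside are
    recovered by choice afterwards.\<close>
  define Q where "Q k z \<longleftrightarrow> z \<subseteq> k \<and> (\<exists>y. y \<in> \<A> \<and> \<not> y \<subseteq> a \<and> y \<subseteq> k \<and> y \<inter> z \<subseteq> a)" for k z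
  have "\<exists>X. \<forall>n. good (X n) \<and> Q (X n) (X (Suc n))"
  proof (rule dependent_nat_choice)
    show "\<exists>k. good k" using x unfolding good_def by blast
    show "\<exists>z. good z \<and> Q k z" if "good k" for k using split[OF that] unfolding Q_def by blast
  qed
  then obtain X where "\<forall>n::nat. good (X n) \<and> Q (X n) (X (Suc n))" ..
  then have X: "X (Suc n) \<subseteq> X n"
    "\<exists>y. y \<in> \<A> \<and> \<not> y \<subseteq> a \<and> y \<subseteq> X n \<and> y \<inter> X (Suc n) \<subseteq> a" for n
    by (simp_all add: Q_def)
  have "\<forall>n. \<exists>y. y \<in> \<A> \<and> \<not> y \<subseteq> a \<and> y \<subseteq> X n \<and> y \<inter> X (Suc n) \<subseteq> a"
    using X(2) by (rule allI)
  from choice[OF this] obtain c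
    where "\<forall>n. c n \<in> \<A> \<and> \<not> c n \<subseteq> a \<and> c n \<subseteq> X n \<and> c n \<inter> X (Suc n) \<subseteq> a" ..
  then have c: "c n \<in> \<A>" "\<not> c n \<subseteq> a" "c n \<subseteq> X n" "c n \<inter> X (Suc n) \<subseteq> a" for n
    by simp_all
  have lt: "c m \<inter> c n \<subseteq> a" if "m < n" for m n
  proof -
    have "X n \<subseteq> X (Suc m)" using lift_Suc_antimono_le[of X, OF X(1)] that by simp
    then have "c n \<subseteq> X (Suc m)" using c(3)[of n] by (rule subset_trans[rotated])
    then have "c m \<inter> c n \<subseteq> c m \<inter> X (Suc m)" by (intro Int_mono subset_refl)
    then show ?thesis using c(4) by (rule subset_trans)
  qed
  show False
  proof (rule no_disjoint_sequence[OF a c(1,2)])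
    show "c m \<inter> c n \<subseteq> a" if "m \<noteq> n" for m n
    proof (cases "m < n")
      case False
      then show ?thesis using lt[of n m] that by (simp add: Int_commute)
    qed (rule lt)
  qed
qed

lemma exists_fixed_prime:
  assumes j: "nucleus j" and a: "a \<in> \<A>" "j a = a" and x: "x \<in> \<A>" "\<not> x \<subseteq> a"
  shows "\<exists>p. prime p \<and> j p = p \<and> a \<subseteq> p \<and> \<not> x \<subseteq> p"
proof -
  obtain k where k: "k \<in> \<A>" "k \<subseteq> x" "\<not> k \<subseteq> a"
    and uni: "\<And>y z. y \<in> \<A> \<Longrightarrow> z \<in> \<A> \<Longrightarrow> y \<inter> z \<inter> k \<subseteq> a \<Longrightarrow> y \<inter> k \<subseteq> a \<or> z \<inter> k \<subseteq> a"
    using exists_uniform[OF a(1) x] by (elim bexE conjE) simp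
  \<comment> \<open>Read through the adjunction, primality of \<open>imp k a\<close> is exactly the
    indecomposability of \<open>k\<close> modulo \<open>a\<close>.\<close>
  have "prime (imp k a)"
    unfolding prime_def using uni by (simp add: imp_mem le_imp_iff inter_mem k a)
  moreover have "a \<subseteq> imp k a"
    by (subst le_imp_iff[OF a(1) k(1) a(1)]) simp
  moreover have "\<not> x \<subseteq> imp k a"
    by (subst le_imp_iff[OF x(1) k(1) a(1)]) (use k(2,3) in \<open>simp add: inf.absorb2\<close>)
  ultimately show ?thesis using nucleus_imp[OF j k(1) a] by (intro exI[of _ "imp k a"]) simp
qed

text \<open>Classes are compared through their greatest elements. Fixed primes separate these, so
  sending a class to the points not above it is an order embedding; primality turns meets into
  intersections, and joins become unions.\<close>

lemma spatial_quotient: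
  assumes \<theta>: "frame_congruence \<A> (\<subseteq>) \<theta>"
  shows "spatial (\<A> // \<theta>) (quot_le \<A> (\<subseteq>) \<theta>)"
proof -
  have eq: "equiv \<A> \<theta>" using \<theta> unfolding frame_congruence_def by blast
  have sub: "\<And>x y. (x, y) \<in> \<theta> \<Longrightarrow> x \<in> \<A> \<and> y \<in> \<A>" 
    using eq unfolding equiv_def by blast
  have refl: "\<And>x. x \<in> \<A> \<Longrightarrow> (x, x) \<in> \<theta>" using eq unfolding equiv_def refl_on_def by blast
  have \<theta>sym: "\<And>x y. (x, y) \<in> \<theta> \<Longrightarrow> (y, x) \<in> \<theta>" using eq unfolding equiv_def sym_def by blast
  have \<theta>trans: "\<And>x y z. (x, y) \<in> \<theta> \<Longrightarrow> (y, z) \<in> \<theta> \<Longrightarrow> (x, z) \<in> \<theta>"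
    using eq unfolding equiv_def trans_def by blast
  have cmeet: "(a \<inter> c, b \<inter> d) \<in> \<theta>" if "(a, b) \<in> \<theta>" "(c, d) \<in> \<theta>" for a b c d
  proof -
    have "(fmeet \<A> (\<subseteq>) a c, fmeet \<A> (\<subseteq>) b d) \<in> \<theta>"
      using \<theta> that unfolding frame_congruence_def by blast
    then show ?thesis using sub[OF that(1)] sub[OF that(2)] by (simp add: fmeet_eq)
  qed
  have cjoin: "(join (fst ` P), join (snd ` P)) \<in> \<theta>" if "P \<subseteq> \<theta>" for P
  proof -
    have "fst ` P \<subseteq> \<A>" "snd ` P \<subseteq> \<A>" using sub that by auto
    then show ?thesis using \<theta> that unfolding frame_congruence_def by (metis fjoin_eq)
  qed
  define j where "j a = join (\<theta> `` {a})" for a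
  have j\<theta>: "(j a, a) \<in> \<theta>" if a: "a \<in> \<A>" for a
  proof -
    \<comment> \<open>Every member of the class is paired with \<open>a\<close>: the first
      components join to \<open>j a\<close>, the second to \<open>a\<close>, since the class is
      nonempty. So the class contains its own join.\<close>
    have "(join (fst ` ((\<lambda>x. (x, a)) ` (\<theta> `` {a}))), join (snd ` ((\<lambda>x. (x, a)) ` (\<theta> `` {a})))) \<in> \<theta>"
      by (rule cjoin) (auto intro: \<theta>sym)
    moreover have "fst ` ((\<lambda>x. (x, a)) ` (\<theta> `` {a})) = \<theta> `` {a}" by force
    moreover have "snd ` ((\<lambda>x. (x, a)) ` (\<theta> `` {a})) = {a}" using refl[OF a] by force
    moreover have "join {a} = a" using a join_least[of a "{a}"] join_upper[of a "{a}"] by blast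
    ultimately show ?thesis unfolding j_def by simp
  qed
  have jmem: "j a \<in> \<A>" if "a \<in> \<A>" for a using j\<theta>[OF that] sub by blast
  have jmax: "b \<subseteq> j a" if "(a, b) \<in> \<theta>" for a b
    unfolding j_def using that by (intro join_upper) auto
  have jeq: "j a = j b" if "(a, b) \<in> \<theta>" for a b
    unfolding j_def using equiv_class_eq[OF eq that] by simp
  have jinj: "(a, b) \<in> \<theta>" if "j a = j b" "a \<in> \<A>" "b \<in> \<A>" for a b
    using j\<theta> that \<theta>trans \<theta>sym by metis
  have jidem: "j (j a) = j a" if "a \<in> \<A>" for a using jeq j\<theta> that by blast
  have jinc: "a \<subseteq> j a" if "a \<in> \<A>" for a using jmax refl that by blast
  have jmono: "j a \<subseteq> j b" if ab: "a \<in> \<A>" "b \<in> \<A>" "a \<subseteq> b" for a b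
  proof -
    \<comment> \<open>Joining the two pairs makes \<open>join {j a, j b}\<close> congruent to the
      join of \<open>a\<close> and \<open>b\<close>, which is \<open>b\<close>; maximality of
      \<open>j b\<close> in its class does the rest.\<close>
    have "(join (fst ` {(j a, a), (j b, b)}), join (snd ` {(j a, a), (j b, b)})) \<in> \<theta>"
      by (rule cjoin) (use ab j\<theta> in auto)
    moreover have "join {a, b} = b" using ab join_least[of b "{a, b}"] join_upper[of b "{a, b}"] by blast
    ultimately have "(b, join {j a, j b}) \<in> \<theta>" by (auto intro: \<theta>sym)
    then show ?thesis using jmax join_upper[of "j a" "{j a, j b}"] by blast
  qed
  have jinter: "j (a \<inter> b) = j a \<inter> j b" if ab: "a \<in> \<A>" "b \<in> \<A>" for a b
  proof
    show "j (a \<inter> b) \<subseteq> j a \<inter> j b" using ab jmono inter_mem by simp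
    have "(j a \<inter> j b, a \<inter> b) \<in> \<theta>" using cmeet j\<theta> ab by blast
    then show "j a \<inter> j b \<subseteq> j (a \<inter> b)" using jmax \<theta>sym by blast
  qed
  have nuc: "nucleus j" unfolding nucleus_def using jmem jinc jidem jinter by simp
  have qle: "quot_le \<A> (\<subseteq>) \<theta> (\<theta> `` {a}) (\<theta> `` {b}) \<longleftrightarrow> j a \<subseteq> j b"
    if ab: "a \<in> \<A>" "b \<in> \<A>" for a b
  proof
    assume "quot_le \<A> (\<subseteq>) \<theta> (\<theta> `` {a}) (\<theta> `` {b})"
    then obtain x y where xy: "(a, x) \<in> \<theta>" "(b, y) \<in> \<theta>" "(x, fmeet \<A> (\<subseteq>) x y) \<in> \<theta>"
      unfolding quot_le_def by blast
    have m: "x \<in> \<A>" "y \<in> \<A>" using sub xy by blast+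
    have "j x = j x \<inter> j y" using jeq[OF xy(3)] m by (simp add: fmeet_eq jinter)
    then show "j a \<subseteq> j b" using jeq xy by blast
  next
    assume "j a \<subseteq> j b"
    then have "fmeet \<A> (\<subseteq>) (j a) (j b) = j a" using ab jmem by (auto simp: fmeet_eq)
    moreover have "j a \<in> \<theta> `` {a}" "j b \<in> \<theta> `` {b}" using j\<theta> \<theta>sym ab by auto
    ultimately show "quot_le \<A> (\<subseteq>) \<theta> (\<theta> `` {a}) (\<theta> `` {b})"
      unfolding quot_le_def using refl jmem ab by metis
  qed
  define m where "m X = join X" for X
  have mcl: "m (\<theta> `` {a}) = j a" for a unfolding m_def j_def ..
  have m_mem: "m X \<in> \<A>" "j (m X) = m X" and cls: "\<theta> `` {m X} = X" if X: "X \<in> \<A> // \<theta>" for X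
  proof -
    obtain b where b: "b \<in> \<A>" "X = \<theta> `` {b}" by (rule quotientE[OF X])
    then show "m X \<in> \<A>" "j (m X) = m X" using jmem jidem by (simp_all add: mcl)
    show "\<theta> `` {m X} = X" unfolding b(2) mcl by (rule equiv_class_eq[OF eq j\<theta>[OF b(1)]])
  qed
  define \<psi> where "\<psi> X = {Y \<in> \<A> // \<theta>. prime (m Y) \<and> \<not> m X \<subseteq> m Y}" for X
  \<comment> \<open>\<open>spatial\<close> takes its points to be sets of frame elements, so a class
    \<open>Y\<close> enters as the singleton \<open>{Y}\<close>.\<close>
  define \<phi> where "\<phi> X = (\<lambda>Y. {Y}) ` \<psi> X" for X
  have m_fix: "m (\<theta> `` {a}) = a" "\<theta> `` {a} \<in> \<A> // \<theta>" if "a \<in> \<A>" "j a = a" for a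
    using that mcl by (simp_all add: quotientI)
  have le: "quot_le \<A> (\<subseteq>) \<theta> X Y \<longleftrightarrow> m X \<subseteq> m Y" if X: "X \<in> \<A> // \<theta>" and Y: "Y \<in> \<A> // \<theta>" for X Y
    using qle[OF m_mem(1)[OF X] m_mem(1)[OF Y]] by (simp add: cls m_mem X Y)
  have minj: "X = Y" if X: "X \<in> \<A> // \<theta>" and Y: "Y \<in> \<A> // \<theta>" and eq: "m X = m Y" for X Y
    using cls[OF X, unfolded eq] cls[OF Y] by (metis)
  have \<psi>le: "m X \<subseteq> m Y \<longleftrightarrow> \<psi> X \<subseteq> \<psi> Y" if XY: "X \<in> \<A> // \<theta>" "Y \<in> \<A> // \<theta>" for X Y
  proof
    show "m X \<subseteq> m Y \<Longrightarrow> \<psi> X \<subseteq> \<psi> Y" unfolding \<psi>_def by blast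
  next
    assume s: "\<psi> X \<subseteq> \<psi> Y"
    show "m X \<subseteq> m Y"
    proof (rule ccontr)
      assume n: "\<not> m X \<subseteq> m Y"
      obtain p where p: "prime p" "j p = p" "m Y \<subseteq> p" "\<not> m X \<subseteq> p"
        using exists_fixed_prime[OF nuc m_mem[OF XY(2)] m_mem(1)[OF XY(1)] n] by (elim exE conjE)
      have "p \<in> \<A>" using p(1) by (simp add: prime_def)
      then have "\<theta> `` {p} \<in> \<psi> X" unfolding \<psi>_def using p m_fix by simp
      then have "\<theta> `` {p} \<in> \<psi> Y" using s by (rule subsetD[rotated])
      then show False unfolding \<psi>_def using p m_fix \<open>p \<in> \<A>\<close> by simp
    qed
  qed
  have \<phi>le: "m X \<subseteq> m Y \<longleftrightarrow> \<phi> X \<subseteq> \<phi> Y" if XY: "X \<in> \<A> // \<theta>" "Y \<in> \<A> // \<theta>" for X Y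
    unfolding \<phi>_def \<psi>le[OF XY] by (subst inj_image_subset_iff) (simp_all add: inj_def)
  \<comment> \<open>A fixed element cannot tell \<open>a\<close> from \<open>j a\<close>. Hence
    meets and joins of representatives may be formed in the original frame, without closing them
    under \<open>j\<close>, before comparing with a point.\<close>
  have jle: "j a \<subseteq> m W \<longleftrightarrow> a \<subseteq> m W" if a: "a \<in> \<A>" and W: "W \<in> \<A> // \<theta>" for a W
  proof
    assume "a \<subseteq> m W"
    then have "j a \<subseteq> j (m W)" by (rule jmono[OF a m_mem(1)[OF W]])
    then show "j a \<subseteq> m W" by (simp only: m_mem(2)[OF W])
  qed (rule subset_trans[OF jinc[OF a]])
  show ?thesis
  proof (rule spatialI)
    show "quot_le \<A> (\<subseteq>) \<theta> X Y \<longleftrightarrow> \<phi> X \<subseteq> \<phi> Y" if "X \<in> \<A> // \<theta>" "Y \<in> \<A> // \<theta>" for X Y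
      using le[OF that] \<phi>le[OF that] by simp
    show "inj_on \<phi> (\<A> // \<theta>)"
    proof (rule inj_onI)
      fix X Y assume X: "X \<in> \<A> // \<theta>" and Y: "Y \<in> \<A> // \<theta>" and eq: "\<phi> X = \<phi> Y"
      have "m X \<subseteq> m Y" "m Y \<subseteq> m X"
        unfolding \<phi>le[OF X Y] \<phi>le[OF Y X] eq by (rule subset_refl)+
      then show "X = Y" by (intro minj[OF X Y] subset_antisym)
    qed
  next
    fix X Y assume XY: "X \<in> \<A> // \<theta>" "Y \<in> \<A> // \<theta>"
    have i: "m X \<inter> m Y \<in> \<A>" by (intro inter_mem m_mem(1) XY)
    have "m X \<inter> m Y \<subseteq> m W \<longleftrightarrow> m X \<subseteq> m W \<or> m Y \<subseteq> m W" if "prime (m W)" for W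
    proof
      show "m X \<inter> m Y \<subseteq> m W \<Longrightarrow> m X \<subseteq> m W \<or> m Y \<subseteq> m W"
        using that m_mem(1)[OF XY(1)] m_mem(1)[OF XY(2)] by (simp add: prime_def)
      show "m X \<subseteq> m W \<or> m Y \<subseteq> m W \<Longrightarrow> m X \<inter> m Y \<subseteq> m W"
        by (elim disjE) (simp_all add: le_infI1 le_infI2)
    qed
    then have "W \<in> \<psi> (\<theta> `` {m X \<inter> m Y}) \<longleftrightarrow> W \<in> \<psi> X \<and> W \<in> \<psi> Y" for W
      unfolding \<psi>_def mcl mem_Collect_eq using jle[OF i] by blast
    then have "\<psi> (\<theta> `` {m X \<inter> m Y}) = \<psi> X \<inter> \<psi> Y"
      by (simp add: set_eq_iff)
    then have "\<phi> X \<inter> \<phi> Y = \<phi> (\<theta> `` {m X \<inter> m Y})"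
      unfolding \<phi>_def by (simp add: image_Int inj_def)
    then show "\<phi> X \<inter> \<phi> Y \<in> \<phi> ` (\<A> // \<theta>)" using quotientI[OF i] by simp
  next
    fix S assume S: "S \<subseteq> \<A> // \<theta>"
    have "m ` S \<subseteq> \<A>" using S by (intro image_subsetI m_mem(1)) (rule subsetD)
    then have i: "join (m ` S) \<in> \<A>" by (rule join_mem)
    have "join (m ` S) \<subseteq> m W \<longleftrightarrow> (\<forall>X\<in>S. m X \<subseteq> m W)" if "W \<in> \<A> // \<theta>" for W
      using m_mem[OF that] by (simp add: join_le_iff)
    then have "W \<in> \<psi> (\<theta> `` {join (m ` S)}) \<longleftrightarrow> (\<exists>X\<in>S. W \<in> \<psi> X)" for W
      unfolding \<psi>_def mcl mem_Collect_eq using jle[OF i] by blast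
    then have "\<psi> (\<theta> `` {join (m ` S)}) = (\<Union>X\<in>S. \<psi> X)"
      by (simp add: set_eq_iff)
    then have "\<Union>(\<phi> ` S) = \<phi> (\<theta> `` {join (m ` S)})"
      unfolding \<phi>_def by (simp add: image_UN)
    then show "\<Union>(\<phi> ` S) \<in> \<phi> ` (\<A> // \<theta>)" using quotientI[OF i] by simp
  qed
qed

theorem totally_spatial: "totally_spatial \<A> (\<subseteq>)"
  unfolding totally_spatial_def using is_frame spatial_quotient by blast

end

subsection \<open>Left modules and lifting along direct sums\<close>

lemma gen_submodule_upper: "S \<subseteq> gen_submodule R M S"
  unfolding gen_submodule_def by blast

lemma gen_submodule_least: "\<lbrakk>submodule H R M; S \<subseteq> H\<rbrakk> \<Longrightarrow> gen_submodule R M S \<subseteq> H"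
  unfolding gen_submodule_def by blast

locale lmod =
  fixes R :: "'r ring" and M :: "('r, 'a) module" (structure)
  assumes left_module: "left_module R M"

sublocale lmod \<subseteq> R: ring R + abelian_group M
  using left_module unfolding left_module_def by blast+

context lmod
begin

lemma smult_closed [simp, intro]: "\<lbrakk>r \<in> carrier R; x \<in> carrier M\<rbrakk> \<Longrightarrow> r \<odot> x \<in> carrier M"
  and smult_l_distr: "\<lbrakk>r \<in> carrier R; s \<in> carrier R; x \<in> carrier M\<rbrakk>
    \<Longrightarrow> (r \<oplus>\<^bsub>R\<^esub> s) \<odot> x = r \<odot> x \<oplus> s \<odot> x"
  and smult_r_distr: "\<lbrakk>r \<in> carrier R; x \<in> carrier M; y \<in> carrier M\<rbrakk>
    \<Longrightarrow> r \<odot> (x \<oplus> y) = r \<odot> x \<oplus> r \<odot> y"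
  and smult_assoc: "\<lbrakk>r \<in> carrier R; s \<in> carrier R; x \<in> carrier M\<rbrakk>
    \<Longrightarrow> (r \<otimes>\<^bsub>R\<^esub> s) \<odot> x = r \<odot> (s \<odot> x)"
  and smult_one [simp]: "x \<in> carrier M \<Longrightarrow> \<one>\<^bsub>R\<^esub> \<odot> x = x"
  using left_module unfolding left_module_def by simp_all

lemma smult_l_null [simp]: "x \<in> carrier M \<Longrightarrow> \<zero>\<^bsub>R\<^esub> \<odot> x = \<zero>"
  using smult_l_distr[of "\<zero>\<^bsub>R\<^esub>" "\<zero>\<^bsub>R\<^esub>" x] by (simp add: add.l_cancel_one)

lemma smult_r_null [simp]: "r \<in> carrier R \<Longrightarrow> r \<odot> \<zero> = \<zero>"
  using smult_r_distr[of r "\<zero>" "\<zero>"] by (simp add: add.l_cancel_one)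

lemma smult_minus_one: "x \<in> carrier M \<Longrightarrow> (\<ominus>\<^bsub>R\<^esub> \<one>\<^bsub>R\<^esub>) \<odot> x = \<ominus> x"
  using smult_l_distr[of "\<ominus>\<^bsub>R\<^esub> \<one>\<^bsub>R\<^esub>" "\<one>\<^bsub>R\<^esub>" x] R.l_neg[of "\<one>\<^bsub>R\<^esub>"]
  by (simp add: minus_equality)

lemma submoduleI:
  assumes "H \<subseteq> carrier M" "\<zero> \<in> H" "\<And>x y. \<lbrakk>x \<in> H; y \<in> H\<rbrakk> \<Longrightarrow> x \<oplus> y \<in> H"
    "\<And>r x. \<lbrakk>r \<in> carrier R; x \<in> H\<rbrakk> \<Longrightarrow> r \<odot> x \<in> H"
  shows "submodule H R M"
proof -
  have "\<ominus> x \<in> H" if "x \<in> H" for x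
    using assms(1) assms(4)[of "\<ominus>\<^bsub>R\<^esub> \<one>\<^bsub>R\<^esub>" x] that by (auto simp: smult_minus_one)
  then show ?thesis
    using assms
    by (intro submodule.intro subgroup.intro submodule_axioms.intro) (simp_all add: a_inv_def)
qed

lemma submoduleD:
  assumes "submodule H R M"
  shows "x \<in> H \<Longrightarrow> x \<in> carrier M" "\<zero> \<in> H" "\<lbrakk>x \<in> H; y \<in> H\<rbrakk> \<Longrightarrow> x \<oplus> y \<in> H"
    "\<lbrakk>r \<in> carrier R; x \<in> H\<rbrakk> \<Longrightarrow> r \<odot> x \<in> H"
proof -
  interpret submodule H R M by fact
  show "x \<in> H \<Longrightarrow> x \<in> carrier M" using subset by auto
  show "\<zero> \<in> H" using one_closed by simp
  show "\<lbrakk>x \<in> H; y \<in> H\<rbrakk> \<Longrightarrow> x \<oplus> y \<in> H" using m_closed by simp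
  show "\<lbrakk>r \<in> carrier R; x \<in> H\<rbrakk> \<Longrightarrow> r \<odot> x \<in> H" by (rule smult_closed)
qed

lemma submodule_carrier: "submodule (carrier M) R M"
  by (intro submoduleI) auto

lemma submodule_Inter:
  assumes "\<H> \<noteq> {}" "\<And>H. H \<in> \<H> \<Longrightarrow> submodule H R M"
  shows "submodule (\<Inter>\<H>) R M"
proof (rule submoduleI)
  obtain H where "H \<in> \<H>" using assms(1) by blast
  then show "\<Inter>\<H> \<subseteq> carrier M" using submoduleD(1)[OF assms(2)] by blast
  show "\<zero> \<in> \<Inter>\<H>" using submoduleD(2)[OF assms(2)] by simp
  show "x \<oplus> y \<in> \<Inter>\<H>" if "x \<in> \<Inter>\<H>" "y \<in> \<Inter>\<H>" for x y
    using submoduleD(3)[OF assms(2)] that by simp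
  show "r \<odot> x \<in> \<Inter>\<H>" if "r \<in> carrier R" "x \<in> \<Inter>\<H>" for r x
    using submoduleD(4)[OF assms(2)] that by simp
qed

lemma submodule_gen: "S \<subseteq> carrier M \<Longrightarrow> submodule (gen_submodule R M S) R M"
  unfolding gen_submodule_def by (intro submodule_Inter) (use submodule_carrier in auto)

lemma left_module_restrict:
  assumes H: "submodule H R M"
  shows "left_module R (M\<lparr>carrier := H\<rparr>)"
proof -
  note D = submoduleD[OF H]
  have "abelian_group (M\<lparr>carrier := H\<rparr>)"
  proof (rule abelian_groupI)
    fix x assume "x \<in> carrier (M\<lparr>carrier := H\<rparr>)"
    then show "\<exists>y\<in>carrier (M\<lparr>carrier := H\<rparr>). y \<oplus>\<^bsub>M\<lparr>carrier := H\<rparr>\<^esub> x = \<zero>\<^bsub>M\<lparr>carrier := H\<rparr>\<^esub>"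
      using D(4)[of "\<ominus>\<^bsub>R\<^esub> \<one>\<^bsub>R\<^esub>" x] D(1)[of x]
      by (intro bexI[of _ "(\<ominus>\<^bsub>R\<^esub> \<one>\<^bsub>R\<^esub>) \<odot> x"]) (simp_all add: smult_minus_one l_neg)
  qed (use D in \<open>auto simp: a_ac\<close>)
  then show ?thesis
    unfolding left_module_def
    using D R.ring_axioms by (simp add: smult_l_distr smult_r_distr smult_assoc)
qed

lemma lhom_zero:
  assumes N: "left_module R N" and f: "f \<in> lhom R M N"
  shows "f \<zero> = \<zero>\<^bsub>N\<^esub>"
proof -
  interpret N: lmod R N using N by (rule lmod.intro)
  have "f (\<zero>\<^bsub>R\<^esub> \<odot> \<zero>) = \<zero>\<^bsub>R\<^esub> \<odot>\<^bsub>N\<^esub> f \<zero>"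
    using f R.zero_closed zero_closed unfolding lhom_def by blast
  moreover have "f \<zero> \<in> carrier N" using f unfolding lhom_def by blast
  ultimately show ?thesis by simp
qed

lemma lhomD:
  assumes "f \<in> lhom R M M"
  shows "x \<in> carrier M \<Longrightarrow> f x \<in> carrier M"
    "\<lbrakk>x \<in> carrier M; y \<in> carrier M\<rbrakk> \<Longrightarrow> f (x \<oplus> y) = f x \<oplus> f y"
    "\<lbrakk>r \<in> carrier R; x \<in> carrier M\<rbrakk> \<Longrightarrow> f (r \<odot> x) = r \<odot> f x"
    "f \<zero> = \<zero>"
  using assms lhom_zero[OF left_module assms] unfolding lhom_def by simp_all

lemma lhom_comp: "\<lbrakk>f \<in> lhom R M M; g \<in> lhom R M M\<rbrakk> \<Longrightarrow> (\<lambda>x. f (g x)) \<in> lhom R M M"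
  unfolding lhom_def by simp

lemma lhom_zero_map: "(\<lambda>x. \<zero>) \<in> lhom R M M"
  unfolding lhom_def by simp

lemma submodule_vimage:
  assumes H: "submodule H R M" and f: "f \<in> lhom R M M"
  shows "submodule {x \<in> carrier M. f x \<in> H} R M"
  using submoduleD[OF H] lhomD[OF f] by (intro submoduleI) auto

end

text \<open>A list \<open>[i, x, j, y, \<dots>]\<close> codes the function with value \<open>x\<close> at \<open>i\<close>, \<open>y\<close> at \<open>j\<close>, \<dots> and
  default value \<open>z\<close> elsewhere. In this way a direct sum of copies of \<open>M\<close> indexed by the elements of
  \<open>M\<close> lives on lists, the only type over which projectivity quantifies.\<close>

fun decode :: "'a \<Rightarrow> 'a list \<Rightarrow> 'a \<Rightarrow> 'a" where
  "decode z (i # x # l) = (decode z l)(i := x)"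
| "decode z _ = (\<lambda>_. z)"

text \<open>Many lists code the same function. Fixing one code per function makes the lists in the
  carrier of the direct sum correspond bijectively to finitely supported functions.\<close>

definition encode :: "'a \<Rightarrow> ('a \<Rightarrow> 'a) \<Rightarrow> 'a list" where
  "encode z d = (SOME l. decode z l = d)"

lemma decode_encode:
  assumes "finite {i. d i \<noteq> z}"
  shows "decode z (encode z d) = d"
proof -
  \<comment> \<open>The induction runs over a finite superset of the support, so that resetting the
    value at \<open>a\<close> shrinks the set even where \<open>d a\<close> was already
    \<open>z\<close>.\<close>
  have "\<exists>l. decode z l = d" if "finite A" "{i. d i \<noteq> z} \<subseteq> A" for A
    using that
  proof (induction A arbitrary: d)
    case empty
    then have "decode z [] = d" by auto
    then show ?case ..
  next
    case (insert a A)
    have "{i. (d(a := z)) i \<noteq> z} \<subseteq> A" using insert.prems by auto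
    then obtain l where "decode z l = d(a := z)" using insert.IH by blast
    then have "decode z (a # d a # l) = d" by simp
    then show ?case ..
  qed
  then show ?thesis unfolding encode_def by (rule someI_ex) (use assms in auto)
qed

section \<open>The direct sum of copies of \<open>M\<close>, realised on lists\<close>

context lmod
begin

definition fsupp :: "('a \<Rightarrow> 'a) set" where
  "fsupp = {d. finite {i. d i \<noteq> \<zero>} \<and> (\<forall>i. d i \<in> carrier M)}"

abbreviation dec :: "'a list \<Rightarrow> 'a \<Rightarrow> 'a" where "dec \<equiv> decode \<zero>"
abbreviation enc :: "('a \<Rightarrow> 'a) \<Rightarrow> 'a list" where "enc \<equiv> encode \<zero>"

definition direct_sum :: "('r, 'a list) module" where
  "direct_sum = \<lparr>carrier = enc ` fsupp, monoid.mult = (\<lambda>k l. undefined), one = undefined,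
     zero = enc (\<lambda>_. \<zero>), add = (\<lambda>k l. enc (\<lambda>i. dec k i \<oplus> dec l i)),
     smult = (\<lambda>r l. enc (\<lambda>i. r \<odot> dec l i))\<rparr>"

lemma dec_enc [simp]: "d \<in> fsupp \<Longrightarrow> dec (enc d) = d"
  unfolding fsupp_def by (simp add: decode_encode)

lemma fsupp_closed [simp, intro]: "d \<in> fsupp \<Longrightarrow> d i \<in> carrier M"
  unfolding fsupp_def by blast

lemma fsupp_zero [simp]: "(\<lambda>_. \<zero>) \<in> fsupp"
  unfolding fsupp_def by simp

lemma fsupp_add [simp]: "\<lbrakk>d \<in> fsupp; e \<in> fsupp\<rbrakk> \<Longrightarrow> (\<lambda>i. d i \<oplus> e i) \<in> fsupp"
proof -
  assume de: "d \<in> fsupp" "e \<in> fsupp"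
  have "{i. d i \<oplus> e i \<noteq> \<zero>} \<subseteq> {i. d i \<noteq> \<zero>} \<union> {i. e i \<noteq> \<zero>}" by auto
  then have "finite {i. d i \<oplus> e i \<noteq> \<zero>}"
    using de unfolding fsupp_def by (auto elim: finite_subset)
  then show ?thesis using de unfolding fsupp_def by simp
qed

lemma fsupp_smult [simp]: "\<lbrakk>r \<in> carrier R; d \<in> fsupp\<rbrakk> \<Longrightarrow> (\<lambda>i. r \<odot> d i) \<in> fsupp"
proof -
  assume rd: "r \<in> carrier R" "d \<in> fsupp"
  have "{i. r \<odot> d i \<noteq> \<zero>} \<subseteq> {i. d i \<noteq> \<zero>}" using rd by auto
  then have "finite {i. r \<odot> d i \<noteq> \<zero>}"
    using rd unfolding fsupp_def by (auto elim: finite_subset)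
  then show ?thesis using rd unfolding fsupp_def by simp
qed

definition single :: "'a \<Rightarrow> 'a \<Rightarrow> 'a \<Rightarrow> 'a" where
  "single i x = (\<lambda>k. if k = i then x else \<zero>)"

lemma fsupp_single [simp]: "x \<in> carrier M \<Longrightarrow> single i x \<in> fsupp"
  unfolding fsupp_def single_def by simp

lemma single_same [simp]: "single i x i = x" by (simp add: single_def)

lemma fsupp_upd_zero: "d \<in> fsupp \<Longrightarrow> d(a := \<zero>) \<in> fsupp"
  unfolding fsupp_def by (auto elim: finite_subset[rotated])

lemma single_add: "x \<in> carrier M \<Longrightarrow> y \<in> carrier M \<Longrightarrow>
    single i (x \<oplus> y) = (\<lambda>k. single i x k \<oplus> single i y k)"
  unfolding single_def by auto

lemma single_smult: "r \<in> carrier R \<Longrightarrow> single i (r \<odot> x) = (\<lambda>k. r \<odot> single i x k)"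
  unfolding single_def by auto

lemma direct_sum_simps [simp]:
  "carrier direct_sum = enc ` fsupp"
  "\<zero>\<^bsub>direct_sum\<^esub> = enc (\<lambda>_. \<zero>)"
  "d \<in> fsupp \<Longrightarrow> e \<in> fsupp \<Longrightarrow> enc d \<oplus>\<^bsub>direct_sum\<^esub> enc e = enc (\<lambda>i. d i \<oplus> e i)"
  "d \<in> fsupp \<Longrightarrow> r \<odot>\<^bsub>direct_sum\<^esub> enc d = enc (\<lambda>i. r \<odot> d i)"
  unfolding direct_sum_def by simp_all

lemma left_module_direct_sum: "left_module R direct_sum"
proof -
  have "abelian_group direct_sum"
  proof (rule abelian_groupI)
    fix x assume "x \<in> carrier direct_sum"
    then obtain d where d: "d \<in> fsupp" "x = enc d" by auto
    have "(\<ominus>\<^bsub>R\<^esub> \<one>\<^bsub>R\<^esub>) \<odot> d i \<oplus> d i = \<zero>" for i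
      using d(1) by (simp add: smult_minus_one l_neg)
    then show "\<exists>y\<in>carrier direct_sum. y \<oplus>\<^bsub>direct_sum\<^esub> x = \<zero>\<^bsub>direct_sum\<^esub>"
      using d by (intro bexI[of _ "enc (\<lambda>i. (\<ominus>\<^bsub>R\<^esub> \<one>\<^bsub>R\<^esub>) \<odot> d i)"]) simp_all
  qed (auto simp: a_ac)
  then show ?thesis
    unfolding left_module_def
    using R.ring_axioms by (auto simp: smult_l_distr smult_r_distr smult_assoc)
qed

lemma single_lhom: "(\<lambda>x. enc (single i x)) \<in> lhom R M direct_sum"
  unfolding lhom_def by (auto simp: single_add single_smult)

text \<open>A finitely supported function is a finite sum of functions
  \<open>single a (d a)\<close>, each in the image of a coordinate embedding of
  \<open>M\<close>.\<close>

lemma M_generated_direct_sum: "M_generated R M direct_sum"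
proof -
  interpret D: lmod R direct_sum by (rule lmod.intro) (rule left_module_direct_sum)
  let ?U = "\<Union>f\<in>lhom R M direct_sum. f ` carrier M"
  have U: "?U \<subseteq> carrier direct_sum" unfolding lhom_def by blast
  note S = D.submoduleD[OF D.submodule_gen[OF U]]
  have mem: "enc d \<in> gen_submodule R direct_sum ?U"
    if "finite A" "d \<in> fsupp" "{i. d i \<noteq> \<zero>} \<subseteq> A" for A d
    using that
  proof (induction A arbitrary: d)
    case empty
    then have "d = (\<lambda>_. \<zero>)" by auto
    then show ?case using S(2) by simp
  next
    case (insert a A)
    let ?e = "d(a := \<zero>)"
    have e: "?e \<in> fsupp" using insert.prems by (simp add: fsupp_upd_zero)
    have "enc ?e \<in> gen_submodule R direct_sum ?U"
      by (rule insert.IH[OF e]) (use insert.prems in auto)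
    moreover have "enc (single a (d a)) \<in> gen_submodule R direct_sum ?U"
      using single_lhom[of a] insert.prems
      by (intro subsetD[OF gen_submodule_upper]) blast
    ultimately have "enc (single a (d a)) \<oplus>\<^bsub>direct_sum\<^esub> enc ?e \<in> gen_submodule R direct_sum ?U"
      by (intro S(3))
    moreover have "(\<lambda>i. single a (d a) i \<oplus> ?e i) = d"
      using insert.prems by (auto simp: single_def)
    moreover have "enc (single a (d a)) \<oplus>\<^bsub>direct_sum\<^esub> enc ?e = enc (\<lambda>i. single a (d a) i \<oplus> ?e i)"
      by (rule direct_sum_simps(3)[OF fsupp_single e]) (use insert.prems in simp)
    ultimately show ?case by (simp only:)
  qed
  have "carrier direct_sum \<subseteq> gen_submodule R direct_sum ?U"
    unfolding direct_sum_simps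
  proof (rule image_subsetI)
    fix d assume d: "d \<in> fsupp"
    then have "finite {i. d i \<noteq> \<zero>}" unfolding fsupp_def by simp
    then show "enc d \<in> gen_submodule R direct_sum ?U" using d subset_refl by (rule mem)
  qed
  then show ?thesis
    unfolding M_generated_def
    using gen_submodule_least[OF D.submodule_carrier U] by blast
qed

lemma in_sigma_restrict:
  assumes "submodule H R direct_sum"
  shows "in_sigma R M (direct_sum\<lparr>carrier := H\<rparr>)"
proof -
  interpret D: lmod R direct_sum by (rule lmod.intro) (rule left_module_direct_sum)
  have "id \<in> lhom R (direct_sum\<lparr>carrier := H\<rparr>) direct_sum"
    using D.submoduleD(1)[OF assms] unfolding lhom_def by (simp del: direct_sum_simps)
  then show ?thesis
    unfolding in_sigma_def
    using D.left_module_restrict[OF assms] left_module_direct_sum M_generated_direct_sum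
    by (meson inj_on_id)
qed

lemma smult_finsum:
  assumes "finite A" "r \<in> carrier R" "f \<in> A \<rightarrow> carrier M"
  shows "r \<odot> (\<Oplus>i\<in>A. f i) = (\<Oplus>i\<in>A. r \<odot> f i)"
  using assms by (induction A rule: finite_induct) (simp_all add: smult_r_distr Pi_iff)

section \<open>The map from the direct sum to \<open>M\<close> with given components\<close>

definition combine :: "('a \<Rightarrow> 'a \<Rightarrow> 'a) \<Rightarrow> ('a \<Rightarrow> 'a) \<Rightarrow> 'a" where
  "combine h d = (\<Oplus>i\<in>{i. d i \<noteq> \<zero>}. h i (d i))"

context
  fixes h :: "'a \<Rightarrow> 'a \<Rightarrow> 'a"
  assumes h: "\<And>i. h i \<in> lhom R M M"
begin

text \<open>Functions to be added or scaled have different supports; this moves all of the sums to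
  one common finite index set.\<close>

lemma combine_eq:
  assumes "d \<in> fsupp" "finite A" "{i. d i \<noteq> \<zero>} \<subseteq> A"
  shows "combine h d = (\<Oplus>i\<in>A. h i (d i))"
  unfolding combine_def
  by (rule add.finprod_mono_neutral_cong_left)
    (use assms lhomD[OF h] in auto)

lemma combine_add:
  assumes d: "d \<in> fsupp" and e: "e \<in> fsupp"
  shows "combine h (\<lambda>i. d i \<oplus> e i) = combine h d \<oplus> combine h e"
proof -
  let ?A = "{i. d i \<noteq> \<zero>} \<union> {i. e i \<noteq> \<zero>}"
  have A: "finite ?A" using d e unfolding fsupp_def by simp
  have "combine h (\<lambda>i. d i \<oplus> e i) = (\<Oplus>i\<in>?A. h i (d i \<oplus> e i))"
    using A d e by (intro combine_eq) auto
  also have "\<dots> = (\<Oplus>i\<in>?A. h i (d i) \<oplus> h i (e i))"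
    using d e lhomD[OF h] by (intro finsum_cong') auto
  also have "\<dots> = (\<Oplus>i\<in>?A. h i (d i)) \<oplus> (\<Oplus>i\<in>?A. h i (e i))"
    using d e lhomD[OF h] by (intro finsum_addf) auto
  also have "\<dots> = combine h d \<oplus> combine h e"
    using combine_eq[OF d A] combine_eq[OF e A] by simp
  finally show ?thesis .
qed

lemma combine_smult:
  assumes d: "d \<in> fsupp" and r: "r \<in> carrier R"
  shows "combine h (\<lambda>i. r \<odot> d i) = r \<odot> combine h d"
proof -
  let ?A = "{i. d i \<noteq> \<zero>}"
  have A: "finite ?A" using d unfolding fsupp_def by simp
  have "combine h (\<lambda>i. r \<odot> d i) = (\<Oplus>i\<in>?A. h i (r \<odot> d i))"
    using A d r by (intro combine_eq) auto
  also have "\<dots> = (\<Oplus>i\<in>?A. r \<odot> h i (d i))"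
    using d r lhomD[OF h] by (intro finsum_cong') auto
  also have "\<dots> = r \<odot> combine h d"
    unfolding combine_def using A d r lhomD[OF h] by (intro smult_finsum[symmetric]) auto
  finally show ?thesis .
qed

lemma combine_single: "x \<in> carrier M \<Longrightarrow> combine h (single i x) = h i x"
proof -
  assume x: "x \<in> carrier M"
  have "combine h (single i x) = (\<Oplus>k\<in>{i}. h k (single i x k))"
    by (rule combine_eq) (use x in \<open>auto simp: single_def intro: fsupp_single[unfolded single_def]\<close>)
  then show ?thesis using lhomD(1)[OF h] x by simp
qed

lemma combine_mem:
  assumes B: "submodule B R M" and d: "d \<in> fsupp" "\<And>i. h i (d i) \<in> B"
  shows "combine h d \<in> B"
proof -
  note D = submoduleD[OF B]
  have "(\<Oplus>i\<in>A. h i (d i)) \<in> B" if "finite A" for A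
    using that
  proof (induction A)
    case (insert a A)
    have "(\<Oplus>i\<in>insert a A. h i (d i)) = h a (d a) \<oplus> (\<Oplus>i\<in>A. h i (d i))"
      using insert.hyps d D(1) by (intro finsum_insert) auto
    then show ?case using insert.IH d D(3) by simp
  qed (simp add: D)
  then show ?thesis using d unfolding combine_def fsupp_def by blast
qed

text \<open>Finitely supported families in \<open>K\<close> are mapped by \<open>combine h\<close>
  onto a submodule \<open>W\<close> containing every \<open>h i (K)\<close>, hence containing the
  image of \<open>f\<close>. Projectivity lifts \<open>f\<close> along this surjection, and
  \<open>\<phi> i\<close> is the \<open>i\<close>-th coordinate of the lift.\<close>

lemma lift_endomorphism:
  assumes proj: "projective_in_sigma R M" and K: "submodule K R M"
    and f: "f \<in> lhom R M M" "f ` carrier M \<subseteq> gen_submodule R M (\<Union>i. h i ` K)"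
  shows "\<exists>\<phi>. (\<forall>i. \<phi> i \<in> lhom R M M) \<and> (\<forall>i. \<forall>x\<in>carrier M. \<phi> i x \<in> K) \<and>
    (\<forall>x\<in>carrier M. (\<lambda>i. \<phi> i x) \<in> fsupp \<and> f x = combine h (\<lambda>i. \<phi> i x))"
proof -
  interpret D: lmod R direct_sum by (rule lmod.intro) (rule left_module_direct_sum)
  note KD = submoduleD[OF K]
  define FK where "FK = {d \<in> fsupp. \<forall>i. d i \<in> K}"
  have FK: "(\<lambda>_. \<zero>) \<in> FK" "\<And>d. d \<in> FK \<Longrightarrow> d \<in> fsupp"
    "\<And>d e. d \<in> FK \<Longrightarrow> e \<in> FK \<Longrightarrow> (\<lambda>i. d i \<oplus> e i) \<in> FK"
    "\<And>r d. r \<in> carrier R \<Longrightarrow> d \<in> FK \<Longrightarrow> (\<lambda>i. r \<odot> d i) \<in> FK"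
    "\<And>i x. x \<in> K \<Longrightarrow> single i x \<in> FK"
    unfolding FK_def using KD by (auto simp: single_def[abs_def] intro: fsupp_single[unfolded single_def])
  define W where "W = combine h ` FK"
  have Wc: "w \<in> carrier M" if "w \<in> W" for w
    using that FK(2) combine_mem[OF submodule_carrier] lhomD(1)[OF h] fsupp_closed unfolding W_def by blast
  have c0: "combine h (\<lambda>_. \<zero>) = \<zero>" by (simp add: combine_def)
  have W: "submodule W R M"
  proof (rule submoduleI)
    show "W \<subseteq> carrier M" using Wc by blast
    show "\<zero> \<in> W" unfolding W_def using c0 FK(1) by (metis imageI)
    show "x \<oplus> y \<in> W" if xy: "x \<in> W" "y \<in> W" for x y
    proof -
      obtain d e where "d \<in> FK" "e \<in> FK" "x = combine h d" "y = combine h e"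
        using xy unfolding W_def by blast
      then have "x \<oplus> y = combine h (\<lambda>i. d i \<oplus> e i)" "(\<lambda>i. d i \<oplus> e i) \<in> FK"
        using FK(2,3) combine_add by simp_all
      then show ?thesis unfolding W_def by blast
    qed
    show "r \<odot> x \<in> W" if rx: "r \<in> carrier R" "x \<in> W" for r x
    proof -
      obtain d where "d \<in> FK" "x = combine h d"
        using rx unfolding W_def by blast
      then have "r \<odot> x = combine h (\<lambda>i. r \<odot> d i)" "(\<lambda>i. r \<odot> d i) \<in> FK"
        using FK(2,4) combine_smult rx by simp_all
      then show ?thesis unfolding W_def by blast
    qed
  qed
  have "h i x \<in> W" if "x \<in> K" for i x
    unfolding W_def using FK(5)[OF that] combine_single[OF KD(1)[OF that]] by (metis imageI)
  then have "gen_submodule R M (\<Union>i. h i ` K) \<subseteq> W" by (intro gen_submodule_least[OF W]) blast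
  then have fW: "f x \<in> W" if "x \<in> carrier M" for x using f(2) that by blast
  define N where "N = direct_sum\<lparr>carrier := enc ` FK\<rparr>"
  \<comment> \<open>The target of the lifting problem must be a module on lists too, so
    \<open>W\<close> is copied into a single coordinate of the direct sum. The index
    \<open>\<zero>\<close> is an arbitrary choice.\<close>
  define s where "s x = enc (single \<zero> x)" for x
  define L where "L = direct_sum\<lparr>carrier := s ` W\<rparr>"
  have s0: "s \<zero> = \<zero>\<^bsub>direct_sum\<^esub>" unfolding s_def by (simp add: single_def)
  have s_add: "s x \<oplus>\<^bsub>direct_sum\<^esub> s y = s (x \<oplus> y)" if "x \<in> carrier M" "y \<in> carrier M" for x y
    unfolding s_def using that by (simp add: single_add)
  have s_smult: "r \<odot>\<^bsub>direct_sum\<^esub> s x = s (r \<odot> x)" if "r \<in> carrier R" "x \<in> carrier M" for r x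
    unfolding s_def using that by (simp add: single_smult)
  have s_inj: "x = y" if "s x = s y" "x \<in> carrier M" "y \<in> carrier M" for x y
  proof -
    have "dec (s x) \<zero> = dec (s y) \<zero>" using that by simp
    then show ?thesis using that by (simp add: s_def)
  qed
  have N: "in_sigma R M N" unfolding N_def
  proof (intro in_sigma_restrict D.submoduleI)
    show "enc ` FK \<subseteq> carrier direct_sum" using FK(2) by auto
    show "\<zero>\<^bsub>direct_sum\<^esub> \<in> enc ` FK" using FK(1) by simp
    show "x \<oplus>\<^bsub>direct_sum\<^esub> y \<in> enc ` FK" if "x \<in> enc ` FK" "y \<in> enc ` FK" for x y
      using that FK(2,3) by auto
    show "r \<odot>\<^bsub>direct_sum\<^esub> x \<in> enc ` FK" if "r \<in> carrier R" "x \<in> enc ` FK" for r x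
      using that FK(2,4) by auto
  qed
  have L: "in_sigma R M L" unfolding L_def
  proof (intro in_sigma_restrict D.submoduleI)
    show "s ` W \<subseteq> carrier direct_sum" using Wc unfolding s_def by auto
    show "\<zero>\<^bsub>direct_sum\<^esub> \<in> s ` W" using submoduleD(2)[OF W] s0[symmetric] by blast
    show "x \<oplus>\<^bsub>direct_sum\<^esub> y \<in> s ` W" if "x \<in> s ` W" "y \<in> s ` W" for x y
      using that submoduleD(3)[OF W] Wc by (auto simp: s_add)
    show "r \<odot>\<^bsub>direct_sum\<^esub> x \<in> s ` W" if "r \<in> carrier R" "x \<in> s ` W" for r x
      using that submoduleD(4)[OF W] Wc by (auto simp: s_smult)
  qed
  define g where "g l = s (combine h (dec l))" for l
  have g_enc: "g (enc d) = s (combine h d)" "combine h d \<in> carrier M" "combine h d \<in> W" if "d \<in> FK" for d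
    using that FK(2) Wc unfolding g_def W_def by auto
  have g: "g \<in> lhom R N L"
    unfolding lhom_def N_def L_def
    using FK(2-4) by (auto simp: g_enc s_add s_smult combine_add combine_smult)
  have "g ` carrier N = carrier L"
    unfolding N_def L_def W_def using g_enc by (auto simp: image_image)
  moreover have "(\<lambda>x. s (f x)) \<in> lhom R M L"
    unfolding lhom_def L_def using fW lhomD[OF f(1)] by (auto simp: s_add s_smult)
  ultimately have "\<exists>k\<in>lhom R M N. \<forall>x\<in>carrier M. g (k x) = s (f x)"
    using proj[unfolded projective_in_sigma_def, rule_format, of N L g "\<lambda>x. s (f x)"] N L g by simp
  then obtain k where k: "k \<in> lhom R M N" and gk: "\<And>x. x \<in> carrier M \<Longrightarrow> g (k x) = s (f x)"
    by (elim bexE) simp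
  have kmem: "\<exists>d\<in>FK. k x = enc d" if "x \<in> carrier M" for x
    using k that unfolding lhom_def N_def by auto
  have dk: "dec (k x) \<in> FK" "enc (dec (k x)) = k x" if "x \<in> carrier M" for x
    using kmem[OF that] FK(2) by (elim bexE; simp)+
  show ?thesis
  proof (intro exI[of _ "\<lambda>i x. dec (k x) i"] conjI allI ballI)
    fix i
    have "dec (k (x \<oplus> y)) i = dec (k x) i \<oplus> dec (k y) i" if xy: "x \<in> carrier M" "y \<in> carrier M" for x y
    proof -
      have "k (x \<oplus> y) = k x \<oplus>\<^bsub>direct_sum\<^esub> k y" using k xy unfolding lhom_def N_def by simp
      then show ?thesis
        using kmem[OF xy(1)] kmem[OF xy(2)] FK(2) by auto
    qed
    moreover have "dec (k (r \<odot> x)) i = r \<odot> dec (k x) i" if rx: "r \<in> carrier R" "x \<in> carrier M" for r x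
    proof -
      have "k (r \<odot> x) = r \<odot>\<^bsub>direct_sum\<^esub> k x" using k rx unfolding lhom_def N_def by simp
      then show ?thesis
        using kmem[OF rx(2)] FK(2) rx(1) by auto
    qed
    ultimately show "(\<lambda>x. dec (k x) i) \<in> lhom R M M"
      unfolding lhom_def using dk(1) FK(2) by simp
  next
    fix x assume x: "x \<in> carrier M"
    show "dec (k x) i \<in> K" for i using dk(1)[OF x] unfolding FK_def by blast
    show "(\<lambda>i. dec (k x) i) \<in> fsupp" using dk(1)[OF x] FK(2) by simp
    have "s (combine h (dec (k x))) = s (f x)"
      using gk[OF x] unfolding g_def .
    then show "f x = combine h (\<lambda>i. dec (k x) i)"
      using s_inj[OF _ g_enc(2)[OF dk(1)[OF x]] lhomD(1)[OF f(1) x]] by simp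
  qed
qed

end

end

subsection \<open>The frame of semiprime submodules\<close>

context lmod
begin

lemma sub_product_le_iff:
  assumes "submodule B R M"
  shows "sub_product R M N L \<subseteq> B \<longleftrightarrow>
    (\<forall>f\<in>lhom R M M. f ` carrier M \<subseteq> L \<longrightarrow> f ` N \<subseteq> B)"
proof
  assume "sub_product R M N L \<subseteq> B"
  then have "\<Union>{f ` N | f. f \<in> lhom R M M \<and> f ` carrier M \<subseteq> L} \<subseteq> B"
    unfolding sub_product_def using gen_submodule_upper by (rule subset_trans[rotated])
  then show "\<forall>f\<in>lhom R M M. f ` carrier M \<subseteq> L \<longrightarrow> f ` N \<subseteq> B" by blast
next
  assume *: "\<forall>f\<in>lhom R M M. f ` carrier M \<subseteq> L \<longrightarrow> f ` N \<subseteq> B"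
  show "sub_product R M N L \<subseteq> B"
    unfolding sub_product_def
  proof (rule gen_submodule_least[OF assms])
    show "\<Union>{f ` N | f. f \<in> lhom R M M \<and> f ` carrier M \<subseteq> L} \<subseteq> B" using * by blast
  qed
qed

lemma sub_productI:
  "\<lbrakk>f \<in> lhom R M M; f ` carrier M \<subseteq> L; x \<in> N\<rbrakk> \<Longrightarrow> f x \<in> sub_product R M N L"
  unfolding sub_product_def by (rule subsetD[OF gen_submodule_upper]) blast

lemma submodule_sub_product:
  assumes "N \<subseteq> carrier M"
  shows "submodule (sub_product R M N L) R M"
  unfolding sub_product_def
proof (rule submodule_gen)
  show "\<Union>{f ` N | f. f \<in> lhom R M M \<and> f ` carrier M \<subseteq> L} \<subseteq> carrier M"
    using assms lhomD(1) by blast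
qed

lemma fully_invariantD:
  assumes "fully_invariant R M N"
  shows "submodule N R M" "N \<subseteq> carrier M" "\<lbrakk>f \<in> lhom R M M; x \<in> N\<rbrakk> \<Longrightarrow> f x \<in> N"
proof -
  show N: "submodule N R M" using assms unfolding fully_invariant_def by simp
  show "N \<subseteq> carrier M" using submoduleD(1)[OF N] by (rule subsetI)
  show "\<lbrakk>f \<in> lhom R M M; x \<in> N\<rbrakk> \<Longrightarrow> f x \<in> N"
    using assms unfolding fully_invariant_def by (simp add: image_subset_iff)
qed

lemma fully_invariantI:
  "\<lbrakk>submodule N R M; \<And>f x. \<lbrakk>f \<in> lhom R M M; x \<in> N\<rbrakk> \<Longrightarrow> f x \<in> N\<rbrakk> \<Longrightarrow> fully_invariant R M N"
  unfolding fully_invariant_def by (simp add: image_subset_iff)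

lemma fully_invariant_carrier: "fully_invariant R M (carrier M)"
  by (rule fully_invariantI[OF submodule_carrier]) (rule lhomD(1))

lemma fully_invariant_Inter:
  assumes "\<N> \<noteq> {}" "\<And>N. N \<in> \<N> \<Longrightarrow> fully_invariant R M N"
  shows "fully_invariant R M (\<Inter>\<N>)"
proof (rule fully_invariantI)
  show "submodule (\<Inter>\<N>) R M"
    by (rule submodule_Inter[OF assms(1)]) (rule fully_invariantD(1)[OF assms(2)])
  show "f x \<in> \<Inter>\<N>" if "f \<in> lhom R M M" "x \<in> \<Inter>\<N>" for f x
    using that by (auto intro: fully_invariantD(3)[OF assms(2)])
qed

text \<open>If \<open>f\<close> maps \<open>M\<close> into \<open>A\<close>, so does its composite
  with an endomorphism \<open>e\<close>, because \<open>A\<close> is fully invariant. Thus the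
  preimage of the product under \<open>e\<close> is a submodule containing all generators.\<close>

lemma fully_invariant_sub_product:
  assumes K: "K \<subseteq> carrier M" and A: "fully_invariant R M A"
  shows "fully_invariant R M (sub_product R M K A)"
proof (rule fully_invariantI[OF submodule_sub_product[OF K]])
  fix e x assume e: "e \<in> lhom R M M" and x: "x \<in> sub_product R M K A"
  have "sub_product R M K A \<subseteq> {x \<in> carrier M. e x \<in> sub_product R M K A}"
  proof (subst sub_product_le_iff)
    show "submodule {x \<in> carrier M. e x \<in> sub_product R M K A} R M"
      by (rule submodule_vimage[OF submodule_sub_product[OF K] e])
    show "\<forall>f\<in>lhom R M M. f ` carrier M \<subseteq> A \<longrightarrow> f ` K \<subseteq> {x \<in> carrier M. e x \<in> sub_product R M K A}"
    proof (intro ballI impI image_subsetI)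
      fix f k assume f: "f \<in> lhom R M M" "f ` carrier M \<subseteq> A" and k: "k \<in> K"
      have "(\<lambda>x. e (f x)) ` carrier M \<subseteq> A"
        using f(2) fully_invariantD(3)[OF A e] by (simp add: image_subset_iff)
      then have "e (f k) \<in> sub_product R M K A"
        by (rule sub_productI[OF lhom_comp[OF e f(1)] _ k])
      moreover have "f k \<in> carrier M" using lhomD(1)[OF f(1)] k K by (simp add: subset_iff)
      ultimately show "f k \<in> {x \<in> carrier M. e x \<in> sub_product R M K A}" by simp
    qed
  qed
  then show "e x \<in> sub_product R M K A" using x by blast
qed

text \<open>Adjoining \<open>carrier M\<close> absorbs the properness clause, since the whole module
  satisfies the remaining conditions trivially.\<close>

lemma SP_iff:
  "N \<in> SP R M \<longleftrightarrow> fully_invariant R M N \<and>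
    (\<forall>K. fully_invariant R M K \<and> sub_product R M K K \<subseteq> N \<longrightarrow> K \<subseteq> N)"
  unfolding SP_def semiprime_sub_def
  using fully_invariant_carrier fully_invariantD(2) by auto

lemma SP_D:
  assumes "N \<in> SP R M"
  shows "fully_invariant R M N"
    "\<lbrakk>fully_invariant R M K; sub_product R M K K \<subseteq> N\<rbrakk> \<Longrightarrow> K \<subseteq> N"
  using assms[unfolded SP_iff] by (blast, blast)

lemma carrier_mem_SP: "carrier M \<in> SP R M"
  unfolding SP_def by simp

lemma SP_Inter:
  assumes "\<N> \<subseteq> SP R M" "\<N> \<noteq> {}"
  shows "\<Inter>\<N> \<in> SP R M"
  unfolding SP_iff
proof (intro conjI allI impI)
  show "fully_invariant R M (\<Inter>\<N>)"
    using assms SP_D(1) by (intro fully_invariant_Inter) auto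
  fix K assume K: "fully_invariant R M K \<and> sub_product R M K K \<subseteq> \<Inter>\<N>"
  show "K \<subseteq> \<Inter>\<N>"
  proof (rule Inter_greatest)
    fix N assume N: "N \<in> \<N>"
    show "K \<subseteq> N"
      by (rule SP_D(2)[of N]) (use assms(1) K N in auto)
  qed
qed

text \<open>The residual \<open>{x. f x \<in> B for all f : M \<rightarrow> A}\<close> is the largest fully invariant \<open>X\<close> with
  \<open>X\<^sub>M A \<subseteq> B\<close>. Projectivity gives
  \<open>(K\<^sub>M A)\<^sub>M (K\<^sub>M A) \<subseteq> (K\<^sub>M K)\<^sub>M A\<close>, whence the residual is semiprime if \<open>B\<close> is.\<close>

definition residual :: "'a set \<Rightarrow> 'a set \<Rightarrow> 'a set" where
  "residual A B = {x \<in> carrier M. \<forall>f\<in>lhom R M M. f ` carrier M \<subseteq> A \<longrightarrow> f x \<in> B}"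

lemma fully_invariant_residual:
  assumes B: "submodule B R M"
  shows "fully_invariant R M (residual A B)"
proof (rule fully_invariantI)
  note D = submoduleD[OF B]
  show "submodule (residual A B) R M"
    unfolding residual_def
    by (rule submoduleI) (auto simp: lhomD D)
  show "e x \<in> residual A B" if e: "e \<in> lhom R M M" and x: "x \<in> residual A B" for e x
    unfolding residual_def
  proof (intro CollectI conjI ballI impI)
    show "e x \<in> carrier M" using lhomD(1)[OF e] x unfolding residual_def by simp
    fix f assume f: "f \<in> lhom R M M" "f ` carrier M \<subseteq> A"
    have "(\<lambda>x. f (e x)) ` carrier M \<subseteq> A" using f(2) lhomD(1)[OF e] by (auto simp: image_subset_iff)
    moreover have "\<forall>g\<in>lhom R M M. g ` carrier M \<subseteq> A \<longrightarrow> g x \<in> B"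
      using x unfolding residual_def by simp
    ultimately show "f (e x) \<in> B" using bspec[OF _ lhom_comp[OF f(1) e]] by blast
  qed
qed

lemma le_residual_iff:
  assumes "submodule B R M" "K \<subseteq> carrier M"
  shows "K \<subseteq> residual A B \<longleftrightarrow> sub_product R M K A \<subseteq> B"
  unfolding sub_product_le_iff[OF assms(1)] residual_def
  using assms(2) by blast

lemma residual_mem_SP:
  assumes proj: "projective_in_sigma R M" and A: "fully_invariant R M A" and B: "B \<in> SP R M"
  shows "residual A B \<in> SP R M"
  unfolding SP_iff
proof (intro conjI allI impI)
  have Bs: "submodule B R M" by (rule fully_invariantD(1)[OF SP_D(1)[OF B]])
  show "fully_invariant R M (residual A B)" by (rule fully_invariant_residual[OF Bs])
  fix K assume asm: "fully_invariant R M K \<and> sub_product R M K K \<subseteq> residual A B"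
  then have K: "fully_invariant R M K" and KK: "sub_product R M K K \<subseteq> residual A B" by simp_all
  note Kc = fully_invariantD(2)[OF K] and Ks = fully_invariantD(1)[OF K]
  define W where "W = sub_product R M K A"
  have W: "fully_invariant R M W" unfolding W_def by (rule fully_invariant_sub_product[OF Kc A])
  have WK: "W \<subseteq> K"
    unfolding W_def sub_product_le_iff[OF Ks] using fully_invariantD(3)[OF K] by blast
  define U where "U = \<Union>{f ` K | f. f \<in> lhom R M M \<and> f ` carrier M \<subseteq> A}"
  \<comment> \<open>Each element of \<open>U\<close> serves as the index of an endomorphism that
    produces it. Indices outside \<open>U\<close> receive the zero map, whose image also lies in
    \<open>A\<close>.\<close>
  have "\<exists>e. e \<in> lhom R M M \<and> e ` carrier M \<subseteq> A \<and> (i \<in> U \<longrightarrow> i \<in> e ` K)" for i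
  proof (cases "i \<in> U")
    case True
    then show ?thesis unfolding U_def by blast
  next
    case False
    then show ?thesis
      using lhom_zero_map submoduleD(2)[OF fully_invariantD(1)[OF A]]
      by (intro exI[of _ "\<lambda>_. \<zero>"]) auto
  qed
  then obtain h where h: "\<And>i. h i \<in> lhom R M M" "\<And>i. h i ` carrier M \<subseteq> A"
      and hU: "\<And>i. i \<in> U \<Longrightarrow> i \<in> h i ` K"
    by metis
  have "U \<subseteq> (\<Union>i. h i ` K)" using hU by blast
  moreover have "(\<Union>i. h i ` K) \<subseteq> carrier M" using lhomD(1)[OF h(1)] Kc by blast
  ultimately have "W \<subseteq> gen_submodule R M (\<Union>i. h i ` K)"
    unfolding W_def sub_product_def U_def[symmetric]
    by (intro gen_submodule_least submodule_gen subset_trans[OF _ gen_submodule_upper])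
  have "sub_product R M W W \<subseteq> B"
    unfolding sub_product_le_iff[OF Bs]
  proof (intro ballI impI image_subsetI)
    fix f w assume f: "f \<in> lhom R M M" "f ` carrier M \<subseteq> W" and w: "w \<in> W"
    have "f ` carrier M \<subseteq> gen_submodule R M (\<Union>i. h i ` K)"
      using f(2) \<open>W \<subseteq> gen_submodule R M (\<Union>i. h i ` K)\<close> by (rule subset_trans)
    from lift_endomorphism[OF h(1) proj Ks f(1) this] obtain \<phi>
      where \<phi>: "\<forall>i. \<phi> i \<in> lhom R M M" "\<forall>i. \<forall>x\<in>carrier M. \<phi> i x \<in> K"
        "\<forall>x\<in>carrier M. (\<lambda>i. \<phi> i x) \<in> fsupp \<and> f x = combine h (\<lambda>i. \<phi> i x)"
      by (elim exE conjE)
    have wK: "w \<in> K" using w WK by blast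
    have wc: "w \<in> carrier M" using wK Kc by blast
    \<comment> \<open>As \<open>w\<close> lies in \<open>K\<close> and \<open>\<phi> i\<close> maps
      \<open>M\<close> into \<open>K\<close>, the coordinate \<open>\<phi> i w\<close> belongs to
      the product of \<open>K\<close> with itself, hence to the residual; \<open>h i\<close> has
      values in \<open>A\<close> and so sends it into \<open>B\<close>.\<close>
    have "h i (\<phi> i w) \<in> B" for i
    proof -
      have "\<phi> i w \<in> sub_product R M K K"
        using \<phi>(1,2) wK by (intro sub_productI image_subsetI) simp_all
      then have "\<phi> i w \<in> residual A B" using KK by blast
      then show ?thesis using h unfolding residual_def by simp
    qed
    then have "combine h (\<lambda>i. \<phi> i w) \<in> B"
      using \<phi>(3) wc by (intro combine_mem[OF h(1) Bs]) simp_all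
    then show "f w \<in> B" using \<phi>(3) wc by simp
  qed
  then have "W \<subseteq> B" by (rule SP_D(2)[OF B W])
  then show "K \<subseteq> residual A B" unfolding le_residual_iff[OF Bs Kc] W_def .
qed

text \<open>Only the frame law has content. For \<open>x\<close> in \<open>s\<close> and
  \<open>f\<close> from \<open>M\<close> into \<open>a\<close>, the value \<open>f x\<close> lies in
  \<open>a\<close> and, by full invariance, in \<open>s\<close>, hence in \<open>b\<close>; so every
  \<open>s\<close>, and with them the join \<open>?J\<close>, lies in \<open>residual a b\<close>.
  The product of \<open>a \<inter> ?J\<close> with itself is then inside \<open>b\<close>, and
  semiprimeness of \<open>b\<close> removes the square.\<close>

lemma set_frame_SP:
  assumes proj: "projective_in_sigma R M"
  shows "set_frame (SP R M) (carrier M)"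
proof
  show "carrier M \<in> SP R M" by (rule carrier_mem_SP)
  show "a \<subseteq> carrier M" if "a \<in> SP R M" for a by (rule fully_invariantD(2)[OF SP_D(1)[OF that]])
  show "\<Inter>S \<in> SP R M" if "S \<subseteq> SP R M" "S \<noteq> {}" for S by (rule SP_Inter[OF that])
next
  fix a b S assume a: "a \<in> SP R M" and b: "b \<in> SP R M" and S: "S \<subseteq> SP R M"
    and le: "\<And>s. s \<in> S \<Longrightarrow> a \<inter> s \<subseteq> b"
  note ai = SP_D(1)[OF a]
  note bs = fully_invariantD(1)[OF SP_D(1)[OF b]]
  let ?J = "\<Inter>{x \<in> SP R M. \<Union>S \<subseteq> x}"
  have res: "residual a b \<in> SP R M" by (rule residual_mem_SP[OF proj ai b])
  have "s \<subseteq> residual a b" if s: "s \<in> S" for s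
  proof -
    have si: "fully_invariant R M s" using S s SP_D(1) by blast
    have "f x \<in> b" if f: "f \<in> lhom R M M" "f ` carrier M \<subseteq> a" and x: "x \<in> s" for f x
    proof -
      have "f x \<in> s" by (rule fully_invariantD(3)[OF si f(1) x])
      moreover have "f x \<in> a" using f(2) fully_invariantD(2)[OF si] x by blast
      ultimately show ?thesis using le[OF s] by blast
    qed
    then show ?thesis using fully_invariantD(2)[OF si] unfolding residual_def by blast
  qed
  then have J: "?J \<subseteq> residual a b" using res by (intro Inter_lower) auto
  have "s \<subseteq> carrier M" if "s \<in> S" for s
    by (rule fully_invariantD(2)[OF SP_D(1)[OF subsetD[OF S that]]])
  then have "carrier M \<in> {x \<in> SP R M. \<Union>S \<subseteq> x}" using carrier_mem_SP by blast
  then have "?J \<in> SP R M" by (intro SP_Inter) auto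
  then have Ji: "fully_invariant R M ?J" by (rule SP_D(1))
  have "fully_invariant R M (\<Inter>{a, ?J})" using ai Ji by (intro fully_invariant_Inter) auto
  then have C: "fully_invariant R M (a \<inter> ?J)" by simp
  show "a \<inter> ?J \<subseteq> b"
  proof (rule SP_D(2)[OF b C])
    show "sub_product R M (a \<inter> ?J) (a \<inter> ?J) \<subseteq> b"
      unfolding sub_product_le_iff[OF bs] using J unfolding residual_def by blast
  qed
qed

end

subsection \<open>Factor modules and uniform dimension\<close>

context lmod
begin

context
  fixes N :: "'a set"
  assumes N: "submodule N R M"
begin

interpretation N: abelian_subgroup N M
  using N abelian_group_axioms
  by (intro abelian_subgroupI3 additive_subgroup.intro submodule.axioms(1))

text \<open>Multiplying a coset elementwise may yield only part of a coset, for instance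
  \<open>{\<zero>}\<close> when \<open>r\<close> is zero; the summand \<open>N\<close> in the scalar
  multiplication of the factor module fills it up.\<close>

lemma factor_module_smult:
  assumes "r \<in> carrier R" "x \<in> carrier M"
  shows "r \<odot>\<^bsub>factor_module R M N\<^esub> (N +> x) = N +> (r \<odot> x)"
proof -
  note D = submoduleD[OF N]
  have "set_add M ((\<lambda>x. r \<odot> x) ` (N +> x)) N = N +> (r \<odot> x)"
  proof (intro equalityI subsetI)
    fix y assume "y \<in> set_add M ((\<lambda>x. r \<odot> x) ` (N +> x)) N"
    then obtain n n' where n: "n \<in> N" "n' \<in> N" "y = r \<odot> (n \<oplus> x) \<oplus> n'"
      unfolding set_add_def' a_r_coset_def' by blast
    have "y = (r \<odot> n \<oplus> n') \<oplus> r \<odot> x"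
      using n(3) assms D(1)[OF n(1)] D(1)[OF n(2)] by (simp add: smult_r_distr a_ac)
    moreover have "r \<odot> n \<oplus> n' \<in> N" using D n assms by simp
    ultimately show "y \<in> N +> (r \<odot> x)" unfolding a_r_coset_def' by blast
  next
    fix y assume "y \<in> N +> (r \<odot> x)"
    then obtain n where n: "n \<in> N" "y = n \<oplus> r \<odot> x" unfolding a_r_coset_def' by blast
    have "y = r \<odot> (\<zero> \<oplus> x) \<oplus> n" using n D(1)[OF n(1)] assms by (simp add: a_comm)
    then show "y \<in> set_add M ((\<lambda>x. r \<odot> x) ` (N +> x)) N"
      unfolding set_add_def' a_r_coset_def' using n(1) D(2) by blast
  qed
  then show ?thesis unfolding factor_module_def by simp
qed

lemma factor_module_simps:
  "carrier (factor_module R M N) = (\<lambda>x. N +> x) ` carrier M"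
  "\<zero>\<^bsub>factor_module R M N\<^esub> = N"
  "\<lbrakk>x \<in> carrier M; y \<in> carrier M\<rbrakk> \<Longrightarrow> (N +> x) \<oplus>\<^bsub>factor_module R M N\<^esub> (N +> y) = N +> (x \<oplus> y)"
proof -
  show "carrier (factor_module R M N) = (\<lambda>x. N +> x) ` carrier M"
    unfolding factor_module_def A_RCOSETS_def' by auto
  show "\<zero>\<^bsub>factor_module R M N\<^esub> = N" unfolding factor_module_def by simp
  show "\<lbrakk>x \<in> carrier M; y \<in> carrier M\<rbrakk> \<Longrightarrow> (N +> x) \<oplus>\<^bsub>factor_module R M N\<^esub> (N +> y) = N +> (x \<oplus> y)"
    unfolding factor_module_def by (simp add: N.a_rcos_sum)
qed

lemma coset_eq_iff: "x \<in> carrier M \<Longrightarrow> N +> x = N \<longleftrightarrow> x \<in> N"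
  using N.a_rcos_self[of x] N.a_rcos_const[of x] by auto

lemma left_module_factor_module: "left_module R (factor_module R M N)"
proof -
  let ?F = "factor_module R M N"
  note simps = factor_module_simps factor_module_smult
  have N0: "N = N +> \<zero>" using coset_eq_iff[of "\<zero>"] submoduleD(2)[OF N] by simp
  have "abelian_group ?F"
  proof (rule abelian_groupI)
    show "x \<oplus>\<^bsub>?F\<^esub> y \<in> carrier ?F" if "x \<in> carrier ?F" "y \<in> carrier ?F" for x y
      using that by (auto simp: simps)
    show "\<zero>\<^bsub>?F\<^esub> \<in> carrier ?F" unfolding simps using N0 by blast
    show "x \<oplus>\<^bsub>?F\<^esub> y \<oplus>\<^bsub>?F\<^esub> z = x \<oplus>\<^bsub>?F\<^esub> (y \<oplus>\<^bsub>?F\<^esub> z)"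
      if "x \<in> carrier ?F" "y \<in> carrier ?F" "z \<in> carrier ?F" for x y z
      using that by (auto simp: simps a_assoc)
    show "x \<oplus>\<^bsub>?F\<^esub> y = y \<oplus>\<^bsub>?F\<^esub> x" if "x \<in> carrier ?F" "y \<in> carrier ?F" for x y
      using that by (auto simp: simps a_comm)
    show "\<zero>\<^bsub>?F\<^esub> \<oplus>\<^bsub>?F\<^esub> x = x" if x: "x \<in> carrier ?F" for x
    proof -
      obtain y where y: "y \<in> carrier M" "x = N +> y" using x unfolding simps by blast
      have "(N +> \<zero>) \<oplus>\<^bsub>?F\<^esub> (N +> y) = N +> y" using y by (simp add: simps)
      then show ?thesis using y N0 by (simp add: simps)
    qed
    show "\<exists>y\<in>carrier ?F. y \<oplus>\<^bsub>?F\<^esub> x = \<zero>\<^bsub>?F\<^esub>" if x: "x \<in> carrier ?F" for x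
    proof -
      obtain y where y: "y \<in> carrier M" "x = N +> y" using x unfolding simps by blast
      have "(N +> \<ominus> y) \<oplus>\<^bsub>?F\<^esub> x = \<zero>\<^bsub>?F\<^esub>" using y N0 by (simp add: simps l_neg)
      moreover have "N +> \<ominus> y \<in> carrier ?F" using y by (simp add: simps)
      ultimately show ?thesis by blast
    qed
  qed
  then show ?thesis
    unfolding left_module_def
    using R.ring_axioms by (auto simp: simps smult_l_distr smult_r_distr smult_assoc)
qed

lemma submodule_factor_module:
  assumes H: "submodule H R M"
  shows "submodule ((\<lambda>x. N +> x) ` H) R (factor_module R M N)"
proof -
  let ?F = "factor_module R M N"
  interpret F: lmod R ?F by (rule lmod.intro) (rule left_module_factor_module)
  note D = submoduleD[OF H]
  note simps = factor_module_simps factor_module_smult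
  show ?thesis
  proof (rule F.submoduleI)
    show "(\<lambda>x. N +> x) ` H \<subseteq> carrier ?F" unfolding simps using D(1) by blast
    have "N = N +> \<zero>" using coset_eq_iff[of "\<zero>"] submoduleD(2)[OF N] by simp
    then show "\<zero>\<^bsub>?F\<^esub> \<in> (\<lambda>x. N +> x) ` H" unfolding simps using D(2) by blast
    show "x \<oplus>\<^bsub>?F\<^esub> y \<in> (\<lambda>x. N +> x) ` H" if "x \<in> (\<lambda>x. N +> x) ` H" "y \<in> (\<lambda>x. N +> x) ` H" for x y
      using that D(1,3) by (auto simp: simps)
    show "r \<odot>\<^bsub>?F\<^esub> x \<in> (\<lambda>x. N +> x) ` H" if "r \<in> carrier R" "x \<in> (\<lambda>x. N +> x) ` H" for r x
      using that D(1,4) by (auto simp: simps)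
  qed
qed

text \<open>The sum of the other \<open>K i\<close> is never computed: \<open>J n\<close> bounds it
  from above, and it is enough that this bound meets \<open>K n\<close> in \<open>N\<close>.\<close>

lemma finite_uniform_dim_factor_no_independent:
  fixes K J :: "nat \<Rightarrow> 'a set"
  assumes fin: "finite_uniform_dim R (factor_module R M N)"
    and K: "\<And>n. submodule (K n) R M" "\<And>n. N \<subset> K n"
    and J: "\<And>n. submodule (J n) R M" "\<And>n i. i \<noteq> n \<Longrightarrow> K i \<subseteq> J n"
    and disj: "\<And>n. K n \<inter> J n = N"
  shows False
proof -
  let ?F = "factor_module R M N"
  let ?K = "\<lambda>n. (\<lambda>x. N +> x) ` K n"
  interpret F: lmod R ?F by (rule lmod.intro) (rule left_module_factor_module)
  have subK: "submodule (?K n) R ?F" for n by (rule submodule_factor_module[OF K(1)])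
  have ne: "?K n \<noteq> {\<zero>\<^bsub>?F\<^esub>}" for n
  proof -
    obtain x where x: "x \<in> K n" "x \<notin> N" using K(2) by blast
    then have "N +> x \<noteq> N" using coset_eq_iff submoduleD(1)[OF K(1)] by blast
    then show ?thesis using x(1) unfolding factor_module_simps by blast
  qed
  have "?K n \<inter> gen_submodule R ?F (\<Union>i\<in>{i. i \<noteq> n}. ?K i) = {\<zero>\<^bsub>?F\<^esub>}" for n
  proof (intro equalityI subsetI)
    have "(\<Union>i\<in>{i. i \<noteq> n}. ?K i) \<subseteq> (\<lambda>x. N +> x) ` J n" using J(2) by blast
    then have "gen_submodule R ?F (\<Union>i\<in>{i. i \<noteq> n}. ?K i) \<subseteq> (\<lambda>x. N +> x) ` J n"
      by (rule gen_submodule_least[OF submodule_factor_module[OF J(1)]])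
    moreover fix X assume "X \<in> ?K n \<inter> gen_submodule R ?F (\<Union>i\<in>{i. i \<noteq> n}. ?K i)"
    ultimately obtain x y where xy: "x \<in> K n" "y \<in> J n" "X = N +> x" "N +> x = N +> y" by blast
    have c: "x \<in> carrier M" using submoduleD(1)[OF K(1) xy(1)] .
    have "x \<in> N +> y" using N.a_rcos_self[OF c] xy(4) by simp
    then obtain z where "z \<in> N" "x = z \<oplus> y" unfolding a_r_coset_def' by blast
    \<comment> \<open>Equal cosets give \<open>x = z \<oplus> y\<close> with \<open>z\<close> in
      \<open>N\<close>; because \<open>J n\<close> contains \<open>N\<close>, the representative
      \<open>x\<close> itself falls into \<open>J n\<close>, so intersections survive the passage to
      cosets.\<close>
    moreover have "N \<subseteq> J n" using disj by blast
    ultimately have "x \<in> J n" using submoduleD(3)[OF J(1)] xy(2) by blast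
    then have "x \<in> N" using xy(1) disj by blast
    then show "X \<in> {\<zero>\<^bsub>?F\<^esub>}" using coset_eq_iff[OF c] xy(3) by (simp add: factor_module_simps)
  next
    fix X assume "X \<in> {\<zero>\<^bsub>?F\<^esub>}"
    moreover have "(\<Union>i\<in>{i. i \<noteq> n}. ?K i) \<subseteq> carrier ?F" using F.submoduleD(1)[OF subK] by blast
    then have "\<zero>\<^bsub>?F\<^esub> \<in> gen_submodule R ?F (\<Union>i\<in>{i. i \<noteq> n}. ?K i)"
      by (rule F.submoduleD(2)[OF F.submodule_gen])
    ultimately show "X \<in> ?K n \<inter> gen_submodule R ?F (\<Union>i\<in>{i. i \<noteq> n}. ?K i)"
      using F.submoduleD(2)[OF subK] by simp
  qed
  then have "\<exists>K. (\<forall>i::nat. submodule (K i) R ?F \<and> K i \<noteq> {\<zero>\<^bsub>?F\<^esub>}) \<and>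
      (\<forall>n. K n \<inter> gen_submodule R ?F (\<Union>i\<in>{i. i \<noteq> n}. K i) = {\<zero>\<^bsub>?F\<^esub>})"
    using subK ne by (intro exI[of _ ?K]) simp
  then show False using fin unfolding finite_uniform_dim_def by (rule notE[rotated])
qed

end

end

theorem theorem4p32:
  fixes R :: "'r ring" and M :: "('r, 'a) module"
  assumes "ring R"
    and "left_module R M"
    and "projective_in_sigma R M"
    and "\<And>N. fully_invariant R M N \<Longrightarrow> finite_uniform_dim R (factor_module R M N)"
  shows "totally_spatial (SP R M) (\<subseteq>)"
proof -
  interpret lmod R M using assms(2) by (rule lmod.intro)
  interpret set_frame "SP R M" "carrier M" by (rule set_frame_SP[OF assms(3)])
  have sub: "submodule N R M" if "N \<in> SP R M" for N
    by (rule fully_invariantD(1)[OF SP_D(1)[OF that]])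
  interpret set_frame_finite_dim "SP R M" "carrier M"
  proof
    fix N K J
    assume N: "N \<in> SP R M" and K: "\<And>n::nat. K n \<in> SP R M" and J: "\<And>n. J n \<in> SP R M"
      and *: "\<And>n. N \<subset> K n" "\<And>n i. i \<noteq> n \<Longrightarrow> K i \<subseteq> J n" "\<And>n. K n \<inter> J n = N"
    show False
    proof (rule finite_uniform_dim_factor_no_independent[of N K J])
      show "finite_uniform_dim R (factor_module R M N)" by (rule assms(4)[OF SP_D(1)[OF N]])
    qed (fact sub[OF N] sub[OF K] sub[OF J] *)+
  qed
  show ?thesis by (rule totally_spatial)
qed

end
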